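(* Let $n\ge 8$ and $t>0$, and suppose $h:\mathbb{R}^n\to\mathbb{R}$ is an even Schwartz function satisfying: (i) $h(x)\ge e^{-t\|x\|^2}$ for every nonzero $x$ in every unimodular integral lattice $\Lambda\subset\mathbb{R}^n$; (ii) $\widehat h(x)\le 0$ for every nonzero $x$ in every unimodular integral lattice $\Lambda\subset\mathbb{R}^n$. Then $$1+\widehat h(0)-h(0)>\Theta_{\mathbb{Z}^n}(t).$$
   Context: A lattice $\Lambda\subset\mathbb{R}^n$ means a full-rank lattice. It is integral if $\langle x,y\rangle\in\mathbb{Z}$ for all $x,y\in\Lambda$, and unimodular if $\operatorname{covol}(\Lambda)=1$. The Gaussian mass of $\Lambda$ is $\Theta_\Lambda(t)=\sum_{x\in\Lambda}e^{-t\|x\|^2}$ for $t>0$. The Fourier transform is $\widehat f(\xi)=\int_{\mathbb{R}^n}f(x)e^{-2\pi i\langle x,\xi\rangle}\,dx$; for $h$ real and even, $\widehat h$ is real-valued. *)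

theory Defs
  imports "HOL-Analysis.Analysis"
begin

section \<open>Lattices\<close>

definition int_lattice :: "(real ^ 'n) set" where
  "int_lattice = {z. \<forall>i. z $ i \<in> \<int>}"

text \<open>The columns of \<open>A\<close> form a \<open>\<int>\<close>-basis of \<open>L\<close>; they are a basis of the whole space.\<close>

definition lattice_basis :: "real ^ 'n ^ 'n \<Rightarrow> (real ^ 'n) set \<Rightarrow> bool" where
  "lattice_basis A L \<longleftrightarrow> invertible A \<and> L = (\<lambda>z. A *v z) ` int_lattice"

definition is_lattice :: "(real ^ 'n) set \<Rightarrow> bool" where
  "is_lattice L \<longleftrightarrow> (\<exists>A. lattice_basis A L)"

text \<open>The value does not depend on the chosen basis, see \<open>covol_eq\<close> below.\<close>

definition covol :: "(real ^ 'n) set \<Rightarrow> real" where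
  "covol L = \<bar>det (SOME A. lattice_basis A L)\<bar>"

definition integral_lattice :: "(real ^ 'n) set \<Rightarrow> bool" where
  "integral_lattice L \<longleftrightarrow> is_lattice L \<and> (\<forall>x\<in>L. \<forall>y\<in>L. x \<bullet> y \<in> \<int>)"

definition unimodular_lattice :: "(real ^ 'n) set \<Rightarrow> bool" where
  "unimodular_lattice L \<longleftrightarrow> is_lattice L \<and> covol L = 1"

lemma lattice_basis_change:
  fixes A B :: "real ^ 'n ^ 'n"
  assumes A: "lattice_basis A L" and B: "lattice_basis B L"
  obtains M where "B = A ** M" "det M \<in> \<int>"
proof -
  have "\<exists>z\<in>int_lattice. B *v axis j 1 = A *v z" for j
  proof -
    have "axis j 1 \<in> (int_lattice :: (real ^ 'n) set)"
      by (auto simp: int_lattice_def axis_def)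
    then show ?thesis
      using A B by (auto simp: lattice_basis_def)
  qed
  then obtain z where z: "\<And>j. z j \<in> int_lattice" "\<And>j. B *v axis j 1 = A *v z j"
    by metis
  define M :: "real ^ 'n ^ 'n" where "M = (\<chi> i j. z j $ i)"
  have "B $ i $ j = (A ** M) $ i $ j" for i j
  proof -
    have "B $ i $ j = (B *v axis j 1) $ i"
      by (simp add: matrix_vector_mult_basis column_def)
    also have "\<dots> = (A *v z j) $ i"
      by (simp only: z(2))
    also have "\<dots> = (A ** M) $ i $ j"
      by (simp add: M_def matrix_vector_mult_def matrix_matrix_mult_def)
    finally show ?thesis .
  qed
  then have "B = A ** M"
    by (simp add: vec_eq_iff)
  moreover have "det M \<in> \<int>"
    using z(1) unfolding det_def M_def int_lattice_def
    by (auto intro!: Ints_sum Ints_mult Ints_prod)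
  ultimately show thesis
    by (rule that)
qed

lemma covol_eq:
  assumes A: "lattice_basis A L"
  shows "covol L = \<bar>det A\<bar>"
proof -
  define B where "B = (SOME A. lattice_basis A L)"
  have B: "lattice_basis B L"
    unfolding B_def using A by (rule someI)
  obtain M where M: "B = A ** M" "det M \<in> \<int>"
    using lattice_basis_change[OF A B] .
  obtain N where N: "A = B ** N" "det N \<in> \<int>"
    using lattice_basis_change[OF B A] .
  have nz: "det A \<noteq> 0"
    using A by (simp add: lattice_basis_def invertible_det_nz)
  have "det A = det A * (det M * det N)"
    using M(1) N(1) by (metis det_mul mult.assoc)
  then have MN: "det M * det N = 1"
    using nz by simp
  obtain m n where mn: "det M = of_int m" "det N = of_int n"
    using M(2) N(2) by (auto elim!: Ints_cases)
  have "m * n = 1"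
    using MN unfolding mn by (metis of_int_eq_1_iff of_int_mult)
  then have "\<bar>m\<bar> = 1"
    by (metis abs_1 abs_minus_cancel pos_zmult_eq_1_iff_lemma)
  then have "\<bar>det M\<bar> = 1"
    by (simp add: mn flip: of_int_abs)
  then show ?thesis
    unfolding covol_def B_def[symmetric] M(1) by (simp add: det_mul abs_mult)
qed

definition gaussian_mass :: "(real ^ 'n) set \<Rightarrow> real \<Rightarrow> real" where
  "gaussian_mass L t = (\<Sum>\<^sub>\<infinity>x\<in>L. exp (- t * (norm x)\<^sup>2))"


section \<open>Schwartz functions and the Fourier transform\<close>

primrec iterated_partial ::
    "'n list \<Rightarrow> (real ^ 'n \<Rightarrow> 'b::real_normed_vector) \<Rightarrow> real ^ 'n \<Rightarrow> 'b" where
  "iterated_partial [] f = f"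
| "iterated_partial (i # is) f =
     (\<lambda>x. frechet_derivative (iterated_partial is f) (at x) (axis i 1))"

text \<open>
  Differentiability of all iterated partial derivatives is \<open>C\<^sup>\<infinity>\<close>-smoothness; it also makes
  every Frechet derivative in \<open>iterated_partial\<close> meaningful. Lists of directions play
  the role of multi-indices.
\<close>

definition schwartz :: "(real ^ 'n \<Rightarrow> 'b::real_normed_vector) \<Rightarrow> bool" where
  "schwartz f \<longleftrightarrow>
     (\<forall>is x. iterated_partial is f differentiable (at x)) \<and>
     (\<forall>is (k::nat). \<exists>C. \<forall>x. norm x ^ k * norm (iterated_partial is f x) \<le> C)"

definition fourier_transform :: "(real ^ 'n \<Rightarrow> complex) \<Rightarrow> real ^ 'n \<Rightarrow> complex" where
  "fourier_transform f \<xi> =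
     (LINT x|lborel. f x * exp (- 2 * of_real pi * \<i> * of_real (x \<bullet> \<xi>)))"

text \<open>
  The Fourier transform of a real even function is real-valued, so nothing is lost by taking
  its real part, see \<open>fourier_transform_real_even\<close> below.
\<close>

definition real_fourier :: "(real ^ 'n \<Rightarrow> real) \<Rightarrow> real ^ 'n \<Rightarrow> real" where
  "real_fourier h \<xi> = Re (fourier_transform (\<lambda>x. complex_of_real (h x)) \<xi>)"

lemma fourier_transform_real_even:
  fixes h :: "real ^ 'n \<Rightarrow> real"
  assumes h: "schwartz h" and even: "\<And>x. h (- x) = h x"
  shows "fourier_transform (\<lambda>x. complex_of_real (h x)) \<xi> = complex_of_real (real_fourier h \<xi>)"
proof -
  define g where
    "g = (\<lambda>x. complex_of_real (h x) * exp (- 2 * of_real pi * \<i> * of_real (x \<bullet> \<xi>)))"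
  have "iterated_partial [] h differentiable (at x)" for x
    using h unfolding schwartz_def by blast
  then have "continuous_on UNIV h"
    by (auto intro!: continuous_at_imp_continuous_on differentiable_imp_continuous_within)
  then have g: "g \<in> borel_measurable borel"
    unfolding g_def by (intro borel_measurable_continuous_onI continuous_intros)
  have lb: "distr lborel borel uminus = (lborel :: (real ^ 'n) measure)"
    using lborel_affine[of "- 1" "0 :: real ^ 'n"] by (simp add: density_1)
  have "cnj (integral\<^sup>L lborel g) = (LINT x|lborel. cnj (g x))"
    by simp
  also have "\<dots> = (LINT x|lborel. g (- x))"
    by (rule Bochner_Integration.integral_cong) (auto simp: even g_def exp_cnj)
  also have "\<dots> = (LINT x|distr lborel borel uminus. g x)"
    by (rule integral_distr[symmetric]) (use g in auto)
  also have "\<dots> = integral\<^sup>L lborel g"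
    by (simp add: lb)
  finally have "integral\<^sup>L lborel g \<in> \<real>"
    by (simp add: Reals_cnj_iff)
  then show ?thesis
    by (simp add: real_fourier_def fourier_transform_def g_def of_real_Re)
qed

end

theory Submission
  imports Defs
begin

text \<open>
  Poisson summation over \<open>R \<int>\<^sup>n\<close>, for \<open>R\<close> orthogonal, gives the inequality with \<open>\<ge>\<close>. Suppose
  equality holds. Then \<open>h\<close> agrees with the Gaussian on \<open>\<int>\<^sup>n - {0}\<close>, and its transform vanishes on
  \<open>R \<int>\<^sup>n - {0}\<close> for every \<open>R\<close>. A vector with half-odd entries on a set \<open>U\<close> of \<open>4\<close> or \<open>8\<close> coordinates and
  integer entries elsewhere lies in some \<open>R \<int>\<^sup>n\<close>, so Poisson summation for \<open>h\<close> twisted by the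
  character \<open>m \<mapsto> (-1) ^ (\<Sum>i\<in>U. m i)\<close> gives
  \<open>h 0 - 1 + \<theta>\<^sub>4 ^ card U * \<theta>\<^sub>3 ^ (n - card U) = 0\<close>. Comparing \<open>card U = 4\<close> with \<open>card U = 8\<close>, which needs
  \<open>n \<ge> 8\<close>, yields \<open>\<theta>\<^sub>3 ^ 4 = \<theta>\<^sub>4 ^ 4\<close>, contradicting \<open>\<bar>\<theta>\<^sub>4\<bar> < \<theta>\<^sub>3\<close>.

  Summability of the transform is never needed: integrating \<open>h\<close> against powers of a nonnegative
  cosine polynomial that concentrates on \<open>\<int>\<^sup>n\<close> involves only finitely many frequencies, and the
  sign condition survives in the limit.
\<close>

section \<open>Sums over the integer lattice\<close>

text \<open>Rotating by \<open>R\<close> changes neither \<open>h 0\<close>, nor the transform at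
  \<open>0\<close>, nor the Gaussian mass, so one equality is an equality for every \<open>R\<close>
  at once. To read off the transform at a single frequency, the Poisson bound must be quantitative:
  it keeps the term of one chosen \<open>k\<close> and discards the others by sign. Half-integral
  frequencies matter because twisting \<open>h\<close> by a sign character shifts the integer
  frequencies onto them. Blocks of four come from two facts: four half-odd numbers have an integer
  sum, and a vector with four entries \<open>1\<close> or \<open>- 1\<close> has squared norm
  \<open>4\<close>, so the reflection in it subtracts half an inner product. The empty
  \<open>U\<close> gives no relation of this kind, since the shifted frequencies would then include
  \<open>0\<close>, where the transform need not vanish. Two nonempty sets are therefore compared,
  which eliminates the unknown \<open>h 0\<close>. The common factor
  \<open>\<theta>\<^sub>4 ^ 4 * \<theta>\<^sub>3 ^ (n - 8)\<close> can be cancelled only if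
  \<theta>4 has no zero; this is obtained from a doubling identity.\<close>

definition cube :: "(real ^ 'n) set" where
  "cube = {x. \<forall>i. - (1/2) \<le> x $ i \<and> x $ i < 1/2}"

lemma int_lattice_0 [simp]: "0 \<in> int_lattice"
  by (simp add: int_lattice_def)

lemma int_lattice_add: "x \<in> int_lattice \<Longrightarrow> y \<in> int_lattice \<Longrightarrow> x + y \<in> int_lattice"
  by (simp add: int_lattice_def)

lemma int_lattice_diff: "x \<in> int_lattice \<Longrightarrow> y \<in> int_lattice \<Longrightarrow> x - y \<in> int_lattice"
  by (simp add: int_lattice_def)

lemma int_lattice_uminus: "x \<in> int_lattice \<Longrightarrow> - x \<in> int_lattice"
  by (simp add: int_lattice_def)

lemma int_lattice_inner: "x \<in> int_lattice \<Longrightarrow> y \<in> int_lattice \<Longrightarrow> x \<bullet> y \<in> \<int>"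
  unfolding int_lattice_def inner_vec_def by (auto intro!: Ints_sum Ints_mult)

lemma axis_int_lattice [simp]: "axis i 1 \<in> int_lattice"
  by (simp add: int_lattice_def axis_def)

lemma bij_betw_int_lattice:
  "bij_betw (\<lambda>f. \<chi> i. real_of_int (f i)) (UNIV :: ('n \<Rightarrow> int) set) (int_lattice :: (real ^ 'n) set)"
proof (rule bij_betwI[where g = "\<lambda>x i. \<lfloor>x $ i\<rfloor>"])
  show "(\<chi> i. real_of_int \<lfloor>x $ i\<rfloor>) = x" if "x \<in> int_lattice" for x :: "real ^ 'n"
    using that by (simp add: int_lattice_def vec_eq_iff)
qed (auto simp: int_lattice_def)

lemma countable_int_lattice: "countable (int_lattice :: (real ^ 'n) set)"
proof -
  have "(int_lattice :: (real ^ 'n) set) \<subseteq> range (\<lambda>f :: int ^ 'n. \<chi> i. real_of_int (f $ i))"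
  proof
    fix x :: "real ^ 'n" assume "x \<in> int_lattice"
    then have "x = (\<chi> i. real_of_int ((\<chi> i. \<lfloor>x $ i\<rfloor>) $ i))"
      by (simp add: int_lattice_def vec_eq_iff)
    then show "x \<in> range (\<lambda>f :: int ^ 'n. \<chi> i. real_of_int (f $ i))" by blast
  qed
  then show ?thesis
    by (rule countable_subset) simp
qed

lemma infinite_int_lattice: "infinite (int_lattice :: (real ^ 'n) set)"
proof -
  have "infinite (range (\<lambda>k :: nat. (\<chi> i. real k) :: real ^ 'n))"
    by (rule range_inj_infinite) (auto simp: inj_on_def vec_eq_iff)
  moreover have "range (\<lambda>k :: nat. (\<chi> i. real k) :: real ^ 'n) \<subseteq> int_lattice"
    by (auto simp: int_lattice_def)
  ultimately show ?thesis
    using finite_subset by blast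
qed

lemma int_lattice_enum:
  obtains e where "bij_betw e (UNIV :: nat set) (int_lattice :: (real ^ 'n) set)"
  using bij_betw_from_nat_into[OF countable_int_lattice infinite_int_lattice] by blast

text \<open>Transporting the sum to functions \<open>'n => int\<close> turns it into a product of
  one-dimensional sums; the floor reads a lattice coordinate back as an integer. Absolute
  summability is what justifies the product rule.\<close>

lemma infsum_int_lattice_prod:
  fixes f :: "'n::finite \<Rightarrow> int \<Rightarrow> real"
  assumes "\<And>i. f i summable_on UNIV"
  shows "(\<lambda>x :: real ^ 'n. norm (\<Prod>i\<in>UNIV. f i \<lfloor>x $ i\<rfloor>)) summable_on int_lattice"
    and "(\<Sum>\<^sub>\<infinity>x\<in>(int_lattice :: (real ^ 'n) set). \<Prod>i\<in>UNIV. f i \<lfloor>x $ i\<rfloor>) = (\<Prod>i\<in>UNIV. \<Sum>\<^sub>\<infinity>k. f i k)"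
proof -
  have abs: "(\<lambda>k. norm (f i k)) summable_on UNIV" for i
    using assms summable_on_iff_abs_summable_on_real by blast
  have PiE: "PiE (UNIV :: 'n set) (\<lambda>_. UNIV :: int set) = UNIV"
    by (auto simp: PiE_def extensional_def)
  have "Infinite_Set_Sum.abs_summable_on (\<lambda>g. \<Prod>i\<in>UNIV. f i (g i)) (PiE (UNIV :: 'n set) (\<lambda>_. UNIV :: int set))"
    by (rule Infinite_Set_Sum.abs_summable_on_prod_PiE) (use abs in \<open>auto simp flip: abs_summable_equivalent\<close>)
  then have "(\<lambda>g. norm (\<Prod>i\<in>UNIV. f i \<lfloor>((\<chi> i. real_of_int (g i)) :: real ^ 'n) $ i\<rfloor>)) summable_on UNIV"
    by (simp add: PiE flip: abs_summable_equivalent)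
  then show "(\<lambda>x :: real ^ 'n. norm (\<Prod>i\<in>UNIV. f i \<lfloor>x $ i\<rfloor>)) summable_on int_lattice"
    using summable_on_reindex_bij_betw[OF bij_betw_int_lattice, where f = "\<lambda>x. norm (\<Prod>i\<in>UNIV. f i \<lfloor>x $ i\<rfloor>)"]
    by blast
  have "(\<Sum>\<^sub>\<infinity>g. \<Prod>i\<in>UNIV. f i (g i)) = (\<Prod>i\<in>UNIV. \<Sum>\<^sub>\<infinity>k. f i k)"
    using infsum_prod_PiE_abs[of "UNIV :: 'n set" f "\<lambda>_. UNIV"] abs by (simp add: PiE)
  then show "(\<Sum>\<^sub>\<infinity>x\<in>(int_lattice :: (real ^ 'n) set). \<Prod>i\<in>UNIV. f i \<lfloor>x $ i\<rfloor>) = (\<Prod>i\<in>UNIV. \<Sum>\<^sub>\<infinity>k. f i k)"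
    using infsum_reindex_bij_betw[OF bij_betw_int_lattice, where f = "\<lambda>x. \<Prod>i\<in>UNIV. f i \<lfloor>x $ i\<rfloor>"]
    by simp
qed

section \<open>Summability of one-dimensional Gaussian series\<close>

lemma summable_inverse_square_int: "(\<lambda>k :: int. 1 / (1 + (real_of_int k)\<^sup>2)) summable_on UNIV"
proof -
  let ?f = "\<lambda>k :: int. 1 / (1 + (real_of_int k)\<^sup>2)"
  have "summable (\<lambda>n. 1 / (1 + (real n)\<^sup>2))"
  proof (rule summable_comparison_test')
    show "summable (\<lambda>n. inverse ((real n)\<^sup>2))"
      using inverse_power_summable[of 2] by simp
    show "norm (1 / (1 + (real n)\<^sup>2)) \<le> inverse ((real n)\<^sup>2)" if "n \<ge> 1" for n
      using that by (simp add: inverse_eq_divide frac_le)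
  qed
  then have "(\<lambda>n :: nat. 1 / (1 + (real n)\<^sup>2)) summable_on UNIV"
    by (intro norm_summable_imp_summable_on) simp
  then have *: "(?f \<circ> int) summable_on UNIV" "(?f \<circ> (\<lambda>n. - int n)) summable_on UNIV"
    by (simp_all add: o_def)
  have "?f summable_on range int" "?f summable_on range (\<lambda>n. - int n)"
    using * by (subst summable_on_reindex; simp add: inj_on_def)+
  then have "?f summable_on (range int \<union> range (\<lambda>n. - int n))"
    by (intro summable_on_union)
  moreover have "range int \<union> range (\<lambda>n. - int n) = UNIV"
    by (auto simp: image_iff intro: int_cases2)
  ultimately show ?thesis by simp
qed

text \<open>The bound \<open>exp (t * y) \<ge> 1 + t * y\<close> reduces the Gaussian to inverse
  squares, and \<open>1 + 1/t\<close> is chosen so that \<open>(1 + 1/t) * (1 + t * y)\<close>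
  dominates \<open>1 + y\<close>. The bounded weights \<open>c\<close> let one statement serve both
  theta series.\<close>

lemma summable_gaussian_int:
  assumes "t > 0" and "\<And>k. \<bar>c k\<bar> \<le> 1"
  shows "(\<lambda>k :: int. c k * exp (- t * (real_of_int k)\<^sup>2)) summable_on UNIV"
proof -
  have "(\<lambda>k :: int. (1 + 1/t) * (1 / (1 + (real_of_int k)\<^sup>2))) summable_on UNIV"
    by (intro summable_on_cmult_right summable_inverse_square_int)
  then have "(\<lambda>k :: int. norm ((1 + 1/t) * (1 / (1 + (real_of_int k)\<^sup>2)))) summable_on UNIV"
    by (rule iffD1[OF summable_on_iff_abs_summable_on_real])
  then have "(\<lambda>k :: int. norm (c k * exp (- t * (real_of_int k)\<^sup>2))) summable_on UNIV"
  proof (rule Infinite_Sum.abs_summable_on_comparison_test)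
    fix k :: int
    define y where "y = (real_of_int k)\<^sup>2"
    have y: "y \<ge> 0" by (simp add: y_def)
    have pos: "1 + t * y > 0"
      using assms(1) y by (simp add: add_pos_nonneg)
    have "exp (t * y) \<ge> 1 + t * y" by (rule exp_ge_add_one_self)
    then have "exp (- t * y) \<le> 1 / (1 + t * y)"
      using pos by (simp add: exp_minus field_simps)
    also have "1 / (1 + t * y) \<le> (1 + 1/t) * (1 / (1 + y))"
    proof -
      have "(1 + 1/t) * (1 + t * y) = 1 + y + (1/t + t * y)"
        using assms(1) by (simp add: algebra_simps)
      moreover have "1/t + t * y \<ge> 0"
        using assms(1) y by simp
      ultimately have "1 + y \<le> (1 + 1/t) * (1 + t * y)"
        by linarith
      then have "(1 + y) / ((1 + y) * (1 + t * y)) \<le> (1 + 1/t) * (1 + t * y) / ((1 + y) * (1 + t * y))"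
        using pos y by (intro divide_right_mono) auto
      then show ?thesis using pos y by simp
    qed
    finally have le: "exp (- t * y) \<le> (1 + 1/t) * (1 / (1 + y))" .
    have "norm (c k * exp (- t * y)) \<le> exp (- t * y)"
      using assms(2)[of k] by (simp add: abs_mult mult_left_le_one_le)
    also note le
    also have "(1 + 1/t) * (1 / (1 + y)) \<le> norm ((1 + 1/t) * (1 / (1 + y)))"
      by (simp only: real_norm_def abs_ge_self)
    finally show "norm (c k * exp (- t * (real_of_int k)\<^sup>2)) \<le> norm ((1 + 1/t) * (1 / (1 + (real_of_int k)\<^sup>2)))"
      unfolding y_def .
  qed
  then show ?thesis
    by (rule iffD2[OF summable_on_iff_abs_summable_on_real])
qed

section \<open>The half-open unit cube as a fundamental domain\<close>

lemma cube_unique: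
  fixes x :: "real ^ 'n"
  assumes "m \<in> int_lattice" "m' \<in> int_lattice" "x - m \<in> cube" "x - m' \<in> cube"
  shows "m = m'"
proof -
  have "m $ i = m' $ i" for i
  proof -
    have "- (1/2) \<le> x $ i - m $ i" "x $ i - m $ i < 1/2" "- (1/2) \<le> x $ i - m' $ i" "x $ i - m' $ i < 1/2"
      using assms by (auto simp: cube_def)
    moreover obtain a b :: int where "m $ i = of_int a" "m' $ i = of_int b"
      using assms(1,2) unfolding int_lattice_def by (metis (mono_tags, lifting) Ints_cases mem_Collect_eq)
    ultimately show ?thesis by auto
  qed
  then show ?thesis by (simp add: vec_eq_iff)
qed

lemma cube_exists:
  fixes x :: "real ^ 'n"
  obtains m where "m \<in> int_lattice" "x - m \<in> cube"
proof
  show "(\<chi> i. real_of_int \<lfloor>x $ i + 1/2\<rfloor>) \<in> int_lattice"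
    by (simp add: int_lattice_def)
  show "x - (\<chi> i. real_of_int \<lfloor>x $ i + 1/2\<rfloor>) \<in> cube"
    unfolding cube_def by (auto; linarith)
qed

lemma sets_cube [measurable]: "cube \<in> sets borel"
  unfolding cube_def by measurable

lemma abs_component_cube_le: "x \<in> cube \<Longrightarrow> \<bar>x $ i\<bar> \<le> 1/2"
  unfolding cube_def by (smt (verit) mem_Collect_eq)

lemma cube_subset_cbox: "cube \<subseteq> cbox (\<chi> i. - (1/2 :: real)) (\<chi> i. (1/2 :: real))"
  by (auto simp: cube_def mem_box_cart less_imp_le)

lemma emeasure_cube_finite: "emeasure lborel (cube :: (real ^ 'n) set) < \<infinity>"
proof -
  have "emeasure lborel (cube :: (real ^ 'n) set) \<le> emeasure lborel (cbox (\<chi> i. - (1/2 :: real)) (\<chi> i. (1/2 :: real)) :: (real ^ 'n) set)"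
    by (intro emeasure_mono cube_subset_cbox) simp
  also have "\<dots> < \<infinity>"
    by (rule emeasure_lborel_cbox_finite)
  finally show ?thesis .
qed

section \<open>Periodization\<close>

lemma lborel_integral_translate:
  fixes f :: "'a :: euclidean_space \<Rightarrow> real"
  assumes [measurable]: "f \<in> borel_measurable borel"
  shows "(LINT x|lborel. f (x + c)) = (LINT x|lborel. f x)"
proof -
  have "(LINT x|lborel. f x) = (LINT x|distr lborel borel ((+) c). f x)"
    by (simp add: lborel_distr_plus)
  also have "\<dots> = (LINT x|lborel. f (c + x))"
    by (rule integral_distr) auto
  finally show ?thesis by (simp add: add.commute)
qed

lemma lborel_nn_integral_translate:
  fixes f :: "'a :: euclidean_space \<Rightarrow> ennreal"
  assumes [measurable]: "f \<in> borel_measurable borel"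
  shows "(\<integral>\<^sup>+ x. f (x + c) \<partial>lborel) = (\<integral>\<^sup>+ x. f x \<partial>lborel)"
proof -
  have "(\<integral>\<^sup>+ x. f x \<partial>lborel) = (\<integral>\<^sup>+ x. f x \<partial>distr lborel borel ((+) c))"
    by (simp add: lborel_distr_plus)
  also have "\<dots> = (\<integral>\<^sup>+ x. f (c + x) \<partial>lborel)"
    by (rule nn_integral_distr) auto
  finally show ?thesis by (simp add: add.commute)
qed

text \<open>Exactly one translate of the half-open cube contains \<open>x\<close>, so the series has
  a single nonzero term. The type of \<open>c\<close> stays general because both \<open>real\<close>
  and \<open>ennreal\<close> occur below.\<close>

lemma sums_indicator_cube:
  fixes x :: "real ^ 'n" and c :: "'b :: {semiring_1, topological_space, t2_space}"
  assumes e: "bij_betw e (UNIV :: nat set) (int_lattice :: (real ^ 'n) set)"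
  shows "(\<lambda>j. indicator cube (x - e j) * c) sums c"
proof -
  obtain m where m: "m \<in> int_lattice" "x - m \<in> cube" by (rule cube_exists)
  then obtain j0 where j0: "m = e j0"
    using bij_betw_imp_surj_on[OF e] by blast
  have el: "e j \<in> int_lattice" for j
    using bij_betw_imp_surj_on[OF e] by blast
  have "indicator cube (x - e j) * c = (if j = j0 then c else 0)" for j
  proof (cases "j = j0")
    case True
    then show ?thesis using m j0 by simp
  next
    case False
    have "x - e j \<notin> cube"
    proof
      assume "x - e j \<in> cube"
      then have "e j = e j0" using cube_unique[OF el _ _ m(2)] m j0 by blast
      then show False using False bij_betw_imp_inj_on[OF e] by (auto dest: injD)
    qed
    then show ?thesis using False by simp
  qed
  then show ?thesis
    using sums_single[of j0 "\<lambda>_. c"] by simp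
qed

text \<open>Unfolding: cut \<open>G\<close> along the translates of \<open>cube\<close> and move
  every piece back into \<open>cube\<close>. Termwise integration is justified on both sides because
  the absolute integrals of finitely many pieces add up to at most the integral of
  \<open>\<bar>G\<bar>\<close>.\<close>

lemma integral_periodize:
  fixes G :: "real ^ 'n \<Rightarrow> real"
  assumes e: "bij_betw e (UNIV :: nat set) (int_lattice :: (real ^ 'n) set)"
    and meas[measurable]: "G \<in> borel_measurable borel" and G: "integrable lborel G"
    and sm: "\<And>x. x \<in> cube \<Longrightarrow> summable (\<lambda>j. \<bar>G (x + e j)\<bar>)"
  shows "(LINT x|lborel. G x) = (LINT x|lborel. indicator cube x * (\<Sum>j. G (x + e j)))"
proof -
  \<comment> \<open>\<open>f j\<close> is the piece of \<open>G\<close> over the \<open>j\<close>-th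
    translate, left in place; \<open>g j\<close> is the same piece moved into
    \<open>cube\<close>.\<close>
  define f where "f = (\<lambda>j x. indicator cube (x - e j) * G x)"
  define g where "g = (\<lambda>j x. indicator cube x * G (x + e j))"
  have [measurable]: "f j \<in> borel_measurable borel" for j
    unfolding f_def by measurable
  have fint: "integrable lborel (f j)" for j
    unfolding f_def
  proof (rule Bochner_Integration.integrable_bound[OF G])
    show "AE x in lborel. norm (indicator cube (x - e j) * G x) \<le> norm (G x)"
      by (auto simp: indicator_def)
  qed measurable
  have fg: "g j x = f j (x + e j)" for j x
    by (simp add: f_def g_def)
  have gint: "integrable lborel (g j)" for j
  proof -
    have "integrable (distr lborel borel ((+) (e j))) (f j)"
      using fint by (simp add: lborel_distr_plus)
    then have "integrable lborel (\<lambda>x. f j (e j + x))"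
      by (subst (asm) integrable_distr_eq) auto
    then show ?thesis by (simp add: fg[abs_def] add.commute)
  qed
  have ifg: "(LINT x|lborel. g j x) = (LINT x|lborel. f j x)" for j
    unfolding fg by (rule lborel_integral_translate) simp
  have ifg': "(LINT x|lborel. norm (g j x)) = (LINT x|lborel. norm (f j x))" for j
    unfolding fg by (rule lborel_integral_translate) simp
  have nf: "norm (f j x) = indicator cube (x - e j) * \<bar>G x\<bar>" for j x
    by (simp add: f_def abs_mult)
  have smf: "(\<lambda>j. norm (f j x)) sums \<bar>G x\<bar>" for x
    unfolding nf by (rule sums_indicator_cube[OF e])
  have smn: "summable (\<lambda>j. LINT x|lborel. norm (f j x))"
  proof (rule summableI_nonneg_bounded)
    show "(\<Sum>j<n. LINT x|lborel. norm (f j x)) \<le> (LINT x|lborel. \<bar>G x\<bar>)" for n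
    proof -
      have "(\<Sum>j<n. LINT x|lborel. norm (f j x)) = (LINT x|lborel. (\<Sum>j<n. norm (f j x)))"
        by (rule Bochner_Integration.integral_sum[symmetric]) (use fint in auto)
      also have "\<dots> \<le> (LINT x|lborel. \<bar>G x\<bar>)"
      proof (rule integral_mono)
        show "(\<Sum>j<n. norm (f j x)) \<le> \<bar>G x\<bar>" for x
          using sum_le_suminf[OF sums_summable[OF smf[of x]], of "{..<n}"] sums_unique[OF smf[of x]] by simp
      qed (use fint G in auto)
      finally show ?thesis .
    qed
  qed simp
  have "(\<lambda>j. LINT x|lborel. f j x) sums (LINT x|lborel. (\<Sum>j. f j x))"
    using fint smn smf by (intro sums_integral) (auto dest: sums_summable)
  also have "(\<lambda>x. \<Sum>j. f j x) = G"
    by (simp add: f_def fun_eq_iff sums_unique[OF sums_indicator_cube[OF e], symmetric])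
  finally have 1: "(\<lambda>j. LINT x|lborel. f j x) sums (LINT x|lborel. G x)" .
  have smg: "summable (\<lambda>j. norm (g j x))" for x
    using sm[of x] by (cases "x \<in> cube") (auto simp: g_def)
  have "(\<lambda>j. LINT x|lborel. g j x) sums (LINT x|lborel. (\<Sum>j. g j x))"
    using gint smn smg by (intro sums_integral) (simp_all only: ifg' always_eventually simp_thms)
  also have "(\<lambda>x. \<Sum>j. g j x) = (\<lambda>x. indicator cube x * (\<Sum>j. G (x + e j)))"
    by (auto simp: g_def fun_eq_iff indicator_def)
  finally have "(\<lambda>j. LINT x|lborel. f j x) sums (LINT x|lborel. indicator cube x * (\<Sum>j. G (x + e j)))"
    by (simp add: ifg)
  then show ?thesis
    by (rule sums_unique2[OF 1])
qed

text \<open>Integrability is the goal here, so the tiling is carried out with \<open>ennreal\<close>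
  integrals of \<open>norm (g x)\<close>, where sum and integral commute unconditionally. The
  \<open>j\<close>-th piece costs at most \<open>M j\<close> times the finite measure of
  \<open>cube\<close>.\<close>

lemma integrable_of_cube_bounds:
  fixes g :: "real ^ 'n \<Rightarrow> real"
  assumes e: "bij_betw e (UNIV :: nat set) (int_lattice :: (real ^ 'n) set)"
    and [measurable]: "g \<in> borel_measurable borel"
    and M: "\<And>x j. x \<in> cube \<Longrightarrow> \<bar>g (x + e j)\<bar> \<le> M j" "summable M"
  shows "integrable lborel g"
proof (rule integrableI_bounded)
  have c0: "(0 :: real ^ 'n) \<in> cube" by (simp add: cube_def)
  have M0: "0 \<le> M j" for j
    using M(1)[OF c0, of j] by linarith
  have "(\<integral>\<^sup>+ x. ennreal (norm (g x)) \<partial>lborel) =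
      (\<integral>\<^sup>+ x. (\<Sum>j. indicator cube (x - e j) * ennreal (norm (g x))) \<partial>lborel)"
    by (rule nn_integral_cong) (rule sums_unique[OF sums_indicator_cube[OF e]])
  also have "\<dots> = (\<Sum>j. \<integral>\<^sup>+ x. indicator cube (x - e j) * ennreal (norm (g x)) \<partial>lborel)"
    by (rule nn_integral_suminf) measurable
  also have "\<dots> = (\<Sum>j. \<integral>\<^sup>+ x. indicator cube x * ennreal (norm (g (x + e j))) \<partial>lborel)"
  proof (rule suminf_cong)
    fix j
    show "(\<integral>\<^sup>+ x. indicator cube (x - e j) * ennreal (norm (g x)) \<partial>lborel) =
        (\<integral>\<^sup>+ x. indicator cube x * ennreal (norm (g (x + e j))) \<partial>lborel)"
      using lborel_nn_integral_translate[of "\<lambda>x. indicator cube (x - e j) * ennreal (norm (g x))" "e j"]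
      by simp
  qed
  also have "\<dots> \<le> (\<Sum>j. ennreal (M j) * emeasure lborel (cube :: (real ^ 'n) set))"
  proof (rule suminf_le)
    fix j
    have "(\<integral>\<^sup>+ x. indicator cube x * ennreal (norm (g (x + e j))) \<partial>lborel) \<le>
       (\<integral>\<^sup>+ x. ennreal (M j) * indicator (cube :: (real ^ 'n) set) x \<partial>lborel)"
      by (rule nn_integral_mono) (auto simp: indicator_def M(1) intro: ennreal_leI)
    then show "(\<integral>\<^sup>+ x. indicator cube x * ennreal (norm (g (x + e j))) \<partial>lborel) \<le>
       ennreal (M j) * emeasure lborel (cube :: (real ^ 'n) set)"
      by (simp add: nn_integral_cmult_indicator)
  qed auto
  also have "\<dots> = (\<Sum>j. ennreal (M j)) * emeasure lborel (cube :: (real ^ 'n) set)"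
    by simp
  also have "\<dots> < \<infinity>"
    using emeasure_cube_finite[where ?'n = 'n] suminf_ennreal2[OF M0 M(2)] by (simp add: ennreal_mult_less_top)
  finally show "(\<integral>\<^sup>+ x. ennreal (norm (g x)) \<partial>lborel) < \<infinity>" .
qed measurable

section \<open>A kernel concentrating on the lattice\<close>

text \<open>Laplace's method: away from its unique maximum \<open>a\<close> the kernel stays below
  some \<open>\<rho> < 1\<close>, while its total mass decays more slowly than
  \<open>\<rho> ^ N\<close>. Two sets occur because the domain of integration \<open>C\<close> need
  not be closed, whereas compactness of \<open>K\<close> supplies the bounds; all that is asked of
  \<open>C\<close> near \<open>a\<close> is positive measure.\<close>

lemma power_kernel_concentrates:
  fixes T \<phi> :: "'a :: euclidean_space \<Rightarrow> real"
  assumes K: "compact K" and C: "C \<in> sets borel" "C \<subseteq> K" and a: "a \<in> K"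
    and pos: "\<And>r. r > 0 \<Longrightarrow> measure lborel (C \<inter> ball a r) > 0"
    and T: "continuous_on K T" "\<And>x. x \<in> K \<Longrightarrow> T x \<ge> 0" "T a = 1" "\<And>x. x \<in> K \<Longrightarrow> x \<noteq> a \<Longrightarrow> T x < 1"
    and \<phi>: "continuous_on K \<phi>"
  shows "(\<lambda>N. (LINT x:C|lborel. \<phi> x * T x ^ N) / (LINT x:C|lborel. T x ^ N)) \<longlonglongrightarrow> \<phi> a"
    and "(LINT x:C|lborel. T x ^ N) > 0"
proof -
  have int: "set_integrable lborel C f" if "continuous_on K f" for f :: "'a \<Rightarrow> real"
  proof (rule set_integrable_subset)
    show "set_integrable lborel K f"
      using borel_integrable_compact[OF K that] by (simp add: set_integrable_def)
  qed (use C in auto)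
  define c where "c = (\<lambda>N. LINT x:C|lborel. T x ^ N)"
  have emC: "emeasure lborel (C \<inter> U) < \<infinity>" for U
  proof -
    have "emeasure lborel (C \<inter> U) \<le> emeasure lborel K"
      using C K by (intro emeasure_mono) (auto simp: compact_imp_closed borel_closed)
    also have "\<dots> < \<infinity>" by (rule emeasure_compact_finite[OF K])
    finally show ?thesis .
  qed
  \<comment> \<open>By continuity \<open>T\<close> exceeds \<open>\<sigma>\<close> on a
    neighbourhood of \<open>a\<close>, and that neighbourhood alone contributes a fixed multiple of
    \<open>\<sigma> ^ N\<close>.\<close>
  have lower: "\<exists>v>0. \<forall>N. \<sigma> ^ N * v \<le> c N" if \<sigma>: "0 \<le> \<sigma>" "\<sigma> < 1" for \<sigma>
  proof -
    obtain \<eta> where \<eta>: "\<eta> > 0" "\<And>x. x \<in> K \<Longrightarrow> dist x a < \<eta> \<Longrightarrow> dist (T x) (T a) < 1 - \<sigma>"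
      using T(1) a \<sigma>(2) unfolding continuous_on_iff by (metis diff_gt_0_iff_gt)
    have C': "C \<inter> ball a \<eta> \<in> sets lborel" using C by auto
    have "\<sigma> ^ N * measure lborel (C \<inter> ball a \<eta>) \<le> c N" for N
    proof -
      have "\<sigma> ^ N * measure lborel (C \<inter> ball a \<eta>) = (LINT x:C \<inter> ball a \<eta>|lborel. \<sigma> ^ N)"
        using C' emC by (subst set_integral_const) (auto simp: less_top)
      also have "\<dots> \<le> (LINT x:C \<inter> ball a \<eta>|lborel. T x ^ N)"
      proof (rule set_integral_mono)
        show "set_integrable lborel (C \<inter> ball a \<eta>) (\<lambda>x. \<sigma> ^ N)"
          by (rule set_integrable_subset[OF int[of "\<lambda>_. \<sigma> ^ N"]]) (use C' in auto)
        show "set_integrable lborel (C \<inter> ball a \<eta>) (\<lambda>x. T x ^ N)"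
          by (rule set_integrable_subset[OF int]) (use C' T in \<open>auto intro!: continuous_intros\<close>)
        show "\<sigma> ^ N \<le> T x ^ N" if "x \<in> C \<inter> ball a \<eta>" for x
        proof (rule power_mono)
          show "\<sigma> \<le> T x"
            using \<eta>(2)[of x] that C T(3) by (auto simp: dist_real_def dist_commute)
        qed (rule \<sigma>)
      qed
      also have "\<dots> \<le> c N"
        unfolding c_def set_lebesgue_integral_def
      proof (rule integral_mono)
        have "set_integrable lborel C (\<lambda>x. T x ^ N)"
          by (rule int) (use T in \<open>auto intro!: continuous_intros\<close>)
        then show "integrable lborel (\<lambda>x. indicator C x *\<^sub>R T x ^ N)"
          and "integrable lborel (\<lambda>x. indicator (C \<inter> ball a \<eta>) x *\<^sub>R T x ^ N)"
          using set_integrable_subset[of lborel C "\<lambda>x. T x ^ N" "C \<inter> ball a \<eta>"] C'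
          by (auto simp: set_integrable_def)
        show "indicator (C \<inter> ball a \<eta>) x *\<^sub>R T x ^ N \<le> indicator C x *\<^sub>R T x ^ N" for x
          using C T(2)[of x] by (auto simp: indicator_def)
      qed
      finally show ?thesis .
    qed
    then show ?thesis using pos[OF \<eta>(1)] by blast
  qed
  have cpos: "c N > 0" for N
  proof -
    obtain v where v: "v > 0" "\<And>N. (1/2) ^ N * v \<le> c N"
      using lower[of "1/2"] by auto
    have "(1/2) ^ N * v > 0" using v(1) by simp
    then show ?thesis using v(2)[of N] by linarith
  qed
  then show "(LINT x:C|lborel. T x ^ N) > 0" by (simp add: c_def)
  have "bounded (\<phi> ` K)" using compact_continuous_image[OF \<phi> K] compact_imp_bounded by blast
  then obtain B where B: "\<And>x. x \<in> K \<Longrightarrow> \<bar>\<phi> x\<bar> \<le> B" unfolding bounded_iff by auto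
  have B0: "B \<ge> 0" using B[OF a] by linarith
  show "(\<lambda>N. (LINT x:C|lborel. \<phi> x * T x ^ N) / (LINT x:C|lborel. T x ^ N)) \<longlonglongrightarrow> \<phi> a"
  proof (rule LIMSEQ_I)
    fix \<epsilon> :: real assume \<epsilon>: "\<epsilon> > 0"
    obtain d where d: "d > 0" "\<And>x. x \<in> K \<Longrightarrow> dist x a < d \<Longrightarrow> dist (\<phi> x) (\<phi> a) < \<epsilon> / 2"
      using \<phi> a \<epsilon> unfolding continuous_on_iff by (metis half_gt_zero)
    have K': "compact (K - ball a d)" using K by (simp add: compact_diff)
    obtain \<rho> where \<rho>: "0 \<le> \<rho>" "\<rho> < 1" "\<And>x. x \<in> K - ball a d \<Longrightarrow> T x \<le> \<rho>"
    proof (cases "K - ball a d = {}")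
      case True
      show ?thesis by (rule that[of 0]) (use True in \<open>simp_all del: Diff_eq_empty_iff\<close>)
    next
      case False
      obtain y where y: "y \<in> K - ball a d" "\<And>x. x \<in> K - ball a d \<Longrightarrow> T x \<le> T y"
        using continuous_attains_sup[OF K' False continuous_on_subset[OF T(1)]] by blast
      then show ?thesis using that[of "T y"] T(2)[of y] T(4)[of y] d(1) by (metis DiffE centre_in_ball)
    qed
    \<comment> \<open>Any number strictly between \<open>\<rho>\<close> and \<open>1\<close> would
      do; it makes \<open>\<rho> / \<sigma> < 1\<close>, and it is positive even when
      \<open>\<rho> = 0\<close>.\<close>
    define \<sigma> where "\<sigma> = (1 + \<rho>) / 2"
    have \<sigma>: "0 \<le> \<sigma>" "\<sigma> < 1" "\<rho> < \<sigma>" "0 < \<sigma>" using \<rho> by (auto simp: \<sigma>_def)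
    obtain v where v: "v > 0" "\<And>N. \<sigma> ^ N * v \<le> c N" using lower[OF \<sigma>(1,2)] by auto
    define D where "D = 2 * B * measure lborel C / v"
    have D0: "D \<ge> 0" using B0 v(1) by (simp add: D_def)
    have est: "\<bar>(LINT x:C|lborel. \<phi> x * T x ^ N) / c N - \<phi> a\<bar> \<le> \<epsilon> / 2 + D * (\<rho> / \<sigma>) ^ N" for N
    proof -
      have i1: "set_integrable lborel C (\<lambda>x. \<phi> x * T x ^ N)"
        by (rule int) (use T \<phi> in \<open>auto intro!: continuous_intros\<close>)
      have i2: "set_integrable lborel C (\<lambda>x. T x ^ N)"
        by (rule int) (use T in \<open>auto intro!: continuous_intros\<close>)
      have i3: "set_integrable lborel C (\<lambda>x. (\<phi> x - \<phi> a) * T x ^ N)"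
        by (rule int) (use T \<phi> in \<open>auto intro!: continuous_intros\<close>)
      have i4: "set_integrable lborel C (\<lambda>x. 2 * B * \<rho> ^ N)"
        by (rule int) simp
      have i5: "set_integrable lborel C (\<lambda>x. \<epsilon> / 2 * T x ^ N)"
        by (rule int) (use T in \<open>auto intro!: continuous_intros\<close>)
      have eq: "(LINT x:C|lborel. \<phi> x * T x ^ N) - \<phi> a * c N = (LINT x:C|lborel. (\<phi> x - \<phi> a) * T x ^ N)"
        unfolding c_def using i1 i2
        by (simp add: left_diff_distrib set_integral_diff)
      have "\<bar>LINT x:C|lborel. (\<phi> x - \<phi> a) * T x ^ N\<bar> \<le> (LINT x:C|lborel. \<bar>(\<phi> x - \<phi> a) * T x ^ N\<bar>)"
        using set_integral_norm_bound[OF i3] by simp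
      also have "\<dots> \<le> (LINT x:C|lborel. \<epsilon> / 2 * T x ^ N + 2 * B * \<rho> ^ N)"
      proof (rule set_integral_mono)
        show "set_integrable lborel C (\<lambda>x. \<bar>(\<phi> x - \<phi> a) * T x ^ N\<bar>)"
          using set_integrable_norm[OF i3] by simp
        show "set_integrable lborel C (\<lambda>x. \<epsilon> / 2 * T x ^ N + 2 * B * \<rho> ^ N)"
          by (rule set_integral_add(1)[OF i5 i4])
        fix x assume "x \<in> C"
        then have xK: "x \<in> K" using C by blast
        have TN: "T x ^ N \<ge> 0" using T(2)[OF xK] by simp
        have rN: "\<rho> ^ N \<ge> 0" using \<rho>(1) by simp
        show "\<bar>(\<phi> x - \<phi> a) * T x ^ N\<bar> \<le> \<epsilon> / 2 * T x ^ N + 2 * B * \<rho> ^ N"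
        proof (cases "dist x a < d")
          case True
          have "\<bar>\<phi> x - \<phi> a\<bar> \<le> \<epsilon> / 2"
            using d(2)[OF xK True] by (simp add: dist_real_def)
          then have "\<bar>\<phi> x - \<phi> a\<bar> * T x ^ N \<le> \<epsilon> / 2 * T x ^ N"
            using TN by (rule mult_right_mono)
          moreover have "2 * B * \<rho> ^ N \<ge> 0" using B0 rN by simp
          ultimately show ?thesis using TN by (simp only: abs_mult abs_of_nonneg)
        next
          case False
          then have "T x \<le> \<rho>" using \<rho>(3)[of x] xK by (auto simp: dist_commute)
          then have "T x ^ N \<le> \<rho> ^ N" using T(2)[OF xK] by (intro power_mono)
          moreover have "\<bar>\<phi> x - \<phi> a\<bar> \<le> 2 * B" using B[OF xK] B[OF a] by linarith
          ultimately have "\<bar>\<phi> x - \<phi> a\<bar> * T x ^ N \<le> 2 * B * \<rho> ^ N"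
            using TN B0 by (intro mult_mono) auto
          moreover have "\<epsilon> / 2 * T x ^ N \<ge> 0" using \<epsilon> TN by simp
          ultimately show ?thesis using TN by (simp only: abs_mult abs_of_nonneg)
        qed
      qed
      also have "\<dots> = \<epsilon> / 2 * c N + 2 * B * \<rho> ^ N * measure lborel C"
        using C emC[of UNIV] set_integral_add(2)[OF i5 i4] unfolding c_def
        by (simp add: set_integral_const less_top mult.commute)
      finally have b: "\<bar>(LINT x:C|lborel. \<phi> x * T x ^ N) - \<phi> a * c N\<bar> \<le> \<epsilon> / 2 * c N + 2 * B * \<rho> ^ N * measure lborel C"
        unfolding eq .
      have "\<bar>(LINT x:C|lborel. \<phi> x * T x ^ N) / c N - \<phi> a\<bar> = \<bar>(LINT x:C|lborel. \<phi> x * T x ^ N) - \<phi> a * c N\<bar> / c N"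
      proof -
        have "(LINT x:C|lborel. \<phi> x * T x ^ N) / c N - \<phi> a = ((LINT x:C|lborel. \<phi> x * T x ^ N) - \<phi> a * c N) / c N"
          using cpos[of N] by (simp add: diff_divide_distrib)
        then show ?thesis
          using cpos[of N] by (simp only: abs_divide abs_of_pos)
      qed
      also have "\<dots> \<le> (\<epsilon> / 2 * c N + 2 * B * \<rho> ^ N * measure lborel C) / c N"
        using b cpos[of N] by (intro divide_right_mono) auto
      also have "\<dots> = \<epsilon> / 2 + 2 * B * \<rho> ^ N * measure lborel C / c N"
        using cpos[of N] by (simp add: add_divide_distrib)
      also have "2 * B * \<rho> ^ N * measure lborel C / c N \<le> 2 * B * \<rho> ^ N * measure lborel C / (\<sigma> ^ N * v)"
        using v \<sigma> B0 \<rho>(1) cpos[of N] by (intro divide_left_mono) auto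
      also have "\<dots> = D * (\<rho> / \<sigma>) ^ N"
        by (simp add: D_def power_divide mult_ac)
      finally show ?thesis by simp
    qed
    have "(\<lambda>N. D * (\<rho> / \<sigma>) ^ N) \<longlonglongrightarrow> D * 0"
      using \<rho> \<sigma> by (intro tendsto_mult tendsto_const LIMSEQ_power_zero) auto
    then have "(\<lambda>N. D * (\<rho> / \<sigma>) ^ N) \<longlonglongrightarrow> 0" by simp
    then obtain N0 where N0: "\<And>N. N \<ge> N0 \<Longrightarrow> norm (D * (\<rho> / \<sigma>) ^ N - 0) < \<epsilon> / 2"
      using \<epsilon> by (metis LIMSEQ_D half_gt_zero)
    show "\<exists>N0. \<forall>N\<ge>N0. norm ((LINT x:C|lborel. \<phi> x * T x ^ N) / (LINT x:C|lborel. T x ^ N) - \<phi> a) < \<epsilon>"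
    proof (intro exI allI impI)
      fix N assume "N \<ge> N0"
      then have "D * (\<rho> / \<sigma>) ^ N < \<epsilon> / 2" using N0[of N] by simp
      then show "norm ((LINT x:C|lborel. \<phi> x * T x ^ N) / (LINT x:C|lborel. T x ^ N) - \<phi> a) < \<epsilon>"
        using est[of N] unfolding c_def by simp
    qed
  qed
qed

text \<open>The compact companion of \<open>cube\<close>: the half-open cube tiles exactly, the
  closed one carries continuity and compactness arguments.\<close>

definition closed_cube :: "(real ^ 'n) set" where
  "closed_cube = {x. \<forall>i. \<bar>x $ i\<bar> \<le> 1/2}"

lemma cube_subset_closed_cube: "cube \<subseteq> closed_cube"
  using abs_component_cube_le by (auto simp: closed_cube_def)

lemma compact_closed_cube: "compact (closed_cube :: (real ^ 'n) set)"
proof -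
  have abs_half: "\<bar>y\<bar> \<le> 1/2 \<longleftrightarrow> - (1/2) \<le> y \<and> y \<le> 1/2" for y :: real
    by linarith
  have "closed_cube = cbox (\<chi> i. - (1/2 :: real)) (\<chi> i :: 'n. (1/2 :: real))"
    by (simp only: closed_cube_def set_eq_iff mem_box_cart mem_Collect_eq vec_lambda_beta abs_half simp_thms)
  then show ?thesis by (metis compact_cbox)
qed

lemma zero_closed_cube [simp]: "0 \<in> closed_cube"
  by (simp add: closed_cube_def)

lemma measure_cube_ball_pos:
  assumes "r > 0"
  shows "measure lborel (cube \<inter> ball (0 :: real ^ 'n) r) > 0"
proof -
  define s where "s = min r (1/2)"
  have s: "s > 0" using assms by (simp add: s_def)
  have "ball (0 :: real ^ 'n) s \<subseteq> cube \<inter> ball 0 r"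
  proof
    fix x :: "real ^ 'n" assume "x \<in> ball 0 s"
    then have n: "norm x < r" "norm x < 1/2" by (auto simp: s_def)
    have "- (1/2) \<le> x $ i \<and> x $ i < 1/2" for i
      using component_le_norm_cart[of x i] n(2) by linarith
    then have "x \<in> cube" unfolding cube_def by blast
    then show "x \<in> cube \<inter> ball 0 r" using n by simp
  qed
  moreover have "cube \<inter> ball (0 :: real ^ 'n) r \<in> fmeasurable lborel"
    by (rule fmeasurable_Int_fmeasurable) (use emeasure_cube_finite in \<open>auto intro: fmeasurableI\<close>)
  ultimately have "measure lborel (ball (0 :: real ^ 'n) s) \<le> measure lborel (cube \<inter> ball (0 :: real ^ 'n) r)"
    by (intro measure_mono_fmeasurable) auto
  moreover have "measure lborel (ball (0 :: real ^ 'n) s) > 0"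
    using content_ball_pos[OF s] by simp
  ultimately show ?thesis by linarith
qed

text \<open>Each summand lies between \<open>0\<close> and \<open>2\<close>, so the normalized sum
  lies between \<open>0\<close> and \<open>1\<close> and reaches \<open>1\<close> only where all
  coordinates are integers; in \<open>closed_cube\<close> this is the origin alone. The coordinate
  is written \<open>axis i 1 \<bullet> x\<close> to exhibit it as an integer frequency.\<close>

definition cos_kernel :: "real ^ 'n \<Rightarrow> real" where
  "cos_kernel x = (1 / (2 * real CARD('n))) * (\<Sum>i\<in>UNIV. 1 + cos (2 * pi * (axis i 1 \<bullet> x)))"

lemma cos_kernel_nonneg: "cos_kernel x \<ge> 0"
  unfolding cos_kernel_def by (intro mult_nonneg_nonneg sum_nonneg) (auto, smt (verit) cos_ge_minus_one)

lemma cos_kernel_0: "cos_kernel 0 = 1"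
  by (simp add: cos_kernel_def)

lemma continuous_cos_kernel: "continuous_on S cos_kernel"
  unfolding cos_kernel_def by (intro continuous_intros)

lemma cos_kernel_less_1:
  fixes x :: "real ^ 'n"
  assumes "x \<in> closed_cube" "x \<noteq> 0"
  shows "cos_kernel x < 1"
proof -
  obtain i where i: "x $ i \<noteq> 0" using assms(2) by (auto simp: vec_eq_iff)
  have "cos (2 * pi * (axis i 1 \<bullet> x)) \<noteq> 1"
  proof
    assume "cos (2 * pi * (axis i 1 \<bullet> x)) = 1"
    then obtain k :: int where "2 * pi * (x $ i) = of_int k * 2 * pi"
      by (auto simp: cos_one_2pi_int inner_axis')
    then have k: "x $ i = of_int k" by simp
    moreover have "\<bar>x $ i\<bar> \<le> 1/2" using assms(1) by (simp add: closed_cube_def)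
    ultimately have "k = 0" by simp
    then show False using i k by simp
  qed
  then have "cos (2 * pi * (axis i 1 \<bullet> x)) < 1"
    using cos_le_one[of "2 * pi * (axis i 1 \<bullet> x)"] by linarith
  then have "(\<Sum>i\<in>UNIV. 1 + cos (2 * pi * (axis i 1 \<bullet> x))) < (\<Sum>i\<in>(UNIV :: 'n set). 2)"
  proof (intro sum_strict_mono_ex1 ballI bexI)
    show "1 + cos (2 * pi * (axis j 1 \<bullet> x)) \<le> 2" for j
      using cos_le_one[of "2 * pi * (axis j 1 \<bullet> x)"] by linarith
    show "1 + cos (2 * pi * (axis i 1 \<bullet> x)) < 2"
      using \<open>cos (2 * pi * (axis i 1 \<bullet> x)) < 1\<close> by linarith
  qed auto
  then show ?thesis by (simp add: cos_kernel_def field_simps)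
qed

text \<open>The weight is a product over the coordinates so that the majorant of a lattice sum factorizes.\<close>

definition decays :: "(real ^ 'n \<Rightarrow> real) \<Rightarrow> bool" where
  "decays g \<longleftrightarrow> continuous_on UNIV g \<and> (\<exists>C. \<forall>x. \<bar>g x\<bar> * (\<Prod>i\<in>UNIV. 1 + (x $ i)\<^sup>2) \<le> C)"

text \<open>A point of \<open>closed_cube\<close> moves each lattice coordinate by at most
  \<open>1/2\<close>, which costs a factor \<open>2\<close> per coordinate in the weight. One
  summable majorant thus serves all of the cube, giving uniform convergence of the periodization as
  well as integrability.\<close>

lemma decays_lattice_bound:
  fixes g :: "real ^ 'n \<Rightarrow> real"
  assumes "decays g"
  obtains M where "M summable_on (int_lattice :: (real ^ 'n) set)"
    "\<And>m x. m \<in> int_lattice \<Longrightarrow> x \<in> closed_cube \<Longrightarrow> \<bar>g (x + m)\<bar> \<le> M m"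
proof -
  obtain C where C: "\<And>x. \<bar>g x\<bar> * (\<Prod>i\<in>UNIV. 1 + (x $ i)\<^sup>2) \<le> C"
    using assms by (auto simp: decays_def)
  have C0: "C \<ge> 0" using C[of 0] abs_ge_zero[of "g 0"] by simp
  define M where "M = (\<lambda>m :: real ^ 'n. C * (\<Prod>i\<in>UNIV. 2 * (1 / (1 + (real_of_int \<lfloor>m $ i\<rfloor>)\<^sup>2))))"
  have "(\<lambda>x :: real ^ 'n. \<Prod>i\<in>UNIV. 2 * (1 / (1 + (real_of_int \<lfloor>x $ i\<rfloor>)\<^sup>2))) summable_on int_lattice"
    by (rule iffD2[OF summable_on_iff_abs_summable_on_real], rule infsum_int_lattice_prod(1))
      (intro summable_on_cmult_right summable_inverse_square_int)
  then have 1: "M summable_on int_lattice"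
    unfolding M_def by (rule summable_on_cmult_right)
  have 2: "\<bar>g (x + m)\<bar> \<le> M m" if m: "m \<in> int_lattice" and x: "x \<in> closed_cube" for m x
  proof -
    define P where "P = (\<Prod>i\<in>UNIV. 1 + ((x + m) $ i)\<^sup>2)"
    have P: "P > 0" unfolding P_def by (intro prod_pos) (auto simp: add_pos_nonneg)
    have "1 \<le> (\<Prod>i\<in>UNIV. 2 * (1 / (1 + (real_of_int \<lfloor>m $ i\<rfloor>)\<^sup>2)) * (1 + ((x + m) $ i)\<^sup>2))"
    proof (rule prod_ge_1)
      fix i
      have mi: "real_of_int \<lfloor>m $ i\<rfloor> = m $ i" using m by (simp add: int_lattice_def)
      have xi: "\<bar>x $ i\<bar> \<le> 1/2" using x by (simp add: closed_cube_def)
      have "(x $ i)\<^sup>2 \<le> (1/2)\<^sup>2" using power_mono[OF xi, of 2] by simp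
      \<comment> \<open>The difference of the two sides is the square of
        \<open>2 * x $ i + m $ i\<close>.\<close>
      moreover have "(m $ i)\<^sup>2 \<le> 2 * ((x + m) $ i)\<^sup>2 + 2 * (x $ i)\<^sup>2"
        using zero_le_power2[of "2 * x $ i + m $ i"] by (simp add: power2_eq_square algebra_simps)
      ultimately have "1 + (m $ i)\<^sup>2 \<le> 2 * (1 + ((x + m) $ i)\<^sup>2)"
        by (simp add: power2_eq_square)
      then show "1 \<le> 2 * (1 / (1 + (real_of_int \<lfloor>m $ i\<rfloor>)\<^sup>2)) * (1 + ((x + m) $ i)\<^sup>2)"
        unfolding mi by (simp add: field_simps add_pos_nonneg)
    qed
    also have "\<dots> = (\<Prod>i\<in>UNIV. 2 * (1 / (1 + (real_of_int \<lfloor>m $ i\<rfloor>)\<^sup>2))) * P"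
      unfolding P_def by (rule prod.distrib)
    finally have "C * 1 \<le> C * ((\<Prod>i\<in>UNIV. 2 * (1 / (1 + (real_of_int \<lfloor>m $ i\<rfloor>)\<^sup>2))) * P)"
      using C0 by (intro mult_left_mono) auto
    then have "\<bar>g (x + m)\<bar> * P \<le> M m * P"
      using C[of "x + m"] unfolding M_def P_def by (simp add: mult.assoc)
    then show ?thesis using P by simp
  qed
  from 1 2 show ?thesis by (rule that)
qed

lemma decays_measurable: "decays g \<Longrightarrow> g \<in> borel_measurable borel"
  by (simp add: decays_def borel_measurable_continuous_onI)

lemma decays_summable:
  fixes g :: "real ^ 'n \<Rightarrow> real"
  assumes "decays g"
  shows "(\<lambda>m. g m) summable_on int_lattice"
proof -
  obtain M where M: "M summable_on (int_lattice :: (real ^ 'n) set)"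
    "\<And>m x. m \<in> int_lattice \<Longrightarrow> x \<in> closed_cube \<Longrightarrow> \<bar>g (x + m)\<bar> \<le> M m"
    using decays_lattice_bound[OF assms] by blast
  have "(\<lambda>m. norm (g m)) summable_on int_lattice"
    by (rule summable_on_comparison_test[OF M(1)]) (use M(2)[of _ 0] in auto)
  then show ?thesis using summable_on_iff_abs_summable_on_real by blast
qed

lemma decays_integrable:
  fixes g :: "real ^ 'n \<Rightarrow> real"
  assumes "decays g"
  shows "integrable lborel g"
proof -
  obtain M where M: "M summable_on (int_lattice :: (real ^ 'n) set)"
    "\<And>m x. m \<in> int_lattice \<Longrightarrow> x \<in> closed_cube \<Longrightarrow> \<bar>g (x + m)\<bar> \<le> M m"
    using decays_lattice_bound[OF assms] by blast
  obtain e where e: "bij_betw e (UNIV :: nat set) (int_lattice :: (real ^ 'n) set)"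
    by (rule int_lattice_enum)
  have el: "e j \<in> int_lattice" for j using bij_betw_imp_surj_on[OF e] by blast
  have "(\<lambda>j. M (e j)) summable_on UNIV"
    using summable_on_reindex_bij_betw[OF e] M(1) by blast
  then have "summable (\<lambda>j. M (e j))" by (rule summable_on_imp_summable)
  then show ?thesis
    using M(2) el cube_subset_closed_cube
    by (intro integrable_of_cube_bounds[OF e decays_measurable[OF assms]]) auto
qed

lemma decays_mult_bounded:
  assumes "decays g" "continuous_on UNIV p" "\<And>x. \<bar>p x\<bar> \<le> B"
  shows "decays (\<lambda>x. g x * p x)"
proof -
  obtain C where C: "\<And>x. \<bar>g x\<bar> * (\<Prod>i\<in>UNIV. 1 + (x $ i)\<^sup>2) \<le> C"
    using assms(1) by (auto simp: decays_def)
  have "\<bar>g x * p x\<bar> * (\<Prod>i\<in>UNIV. 1 + (x $ i)\<^sup>2) \<le> C * B" for x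
  proof -
    have "\<bar>g x\<bar> * (\<Prod>i\<in>UNIV. 1 + (x $ i)\<^sup>2) * \<bar>p x\<bar> \<le> C * B"
    proof (rule mult_mono[OF C assms(3)])
      have "0 \<le> \<bar>g x\<bar> * (\<Prod>i\<in>UNIV. 1 + (x $ i)\<^sup>2)"
        by (intro mult_nonneg_nonneg prod_nonneg) auto
      then show "0 \<le> C" using C[of x] by linarith
    qed auto
    then show ?thesis by (simp add: abs_mult mult_ac)
  qed
  then show ?thesis
    using assms(1,2) by (auto simp: decays_def intro!: continuous_intros)
qed

section \<open>Periodization of functions with product decay\<close>

lemma infsum_eq_suminf:
  fixes f :: "nat \<Rightarrow> real"
  assumes "summable (\<lambda>n. \<bar>f n\<bar>)"
  shows "infsum f UNIV = suminf f"
proof -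
  have "(f has_sum suminf f) UNIV"
    by (rule norm_summable_imp_has_sum) (use assms summable_rabs_cancel in \<open>auto intro: summable_sums\<close>)
  then show ?thesis by (rule infsumI)
qed

definition periodize :: "(real ^ 'n \<Rightarrow> real) \<Rightarrow> real ^ 'n \<Rightarrow> real" where
  "periodize g x = (\<Sum>\<^sub>\<infinity>m\<in>int_lattice. g (x + m))"

lemma continuous_periodize:
  fixes g :: "real ^ 'n \<Rightarrow> real"
  assumes "decays g"
  shows "continuous_on closed_cube (periodize g)"
proof -
  obtain M where M: "M summable_on (int_lattice :: (real ^ 'n) set)"
    "\<And>m x. m \<in> int_lattice \<Longrightarrow> x \<in> closed_cube \<Longrightarrow> \<bar>g (x + m)\<bar> \<le> M m"
    using decays_lattice_bound[OF assms] by blast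
  have g: "continuous_on UNIV g" using assms by (simp add: decays_def)
  show ?thesis
  proof (rule uniform_limit_theorem)
    show "uniform_limit closed_cube (\<lambda>F x. \<Sum>m\<in>F. g (x + m)) (periodize g) (finite_subsets_at_top int_lattice)"
      unfolding periodize_def
      by (rule Weierstrass_m_test_general[OF _ M(1)]) (use M(2) in auto)
    show "\<forall>\<^sub>F F in finite_subsets_at_top int_lattice. continuous_on closed_cube (\<lambda>x. \<Sum>m\<in>F. g (x + m))"
      by (intro always_eventually allI continuous_on_sum)
        (auto intro!: continuous_on_compose2[OF g] continuous_intros)
  qed simp
qed

text \<open>A periodic factor comes out of the lattice sum. With \<open>p\<close> a power of the
  kernel, the integral over the whole space becomes one over \<open>cube\<close>, where
  concentration at \<open>0\<close> yields \<open>periodize g 0\<close>, the lattice sum of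
  \<open>g\<close>.\<close>

lemma integral_mult_periodic:
  fixes g p :: "real ^ 'n \<Rightarrow> real"
  assumes "decays g" and p: "continuous_on UNIV p" "\<And>x. \<bar>p x\<bar> \<le> B"
    and per: "\<And>x m. m \<in> int_lattice \<Longrightarrow> p (x + m) = p x"
  shows "(LINT x|lborel. g x * p x) = (LINT x:cube|lborel. periodize g x * p x)"
proof -
  obtain e where e: "bij_betw e (UNIV :: nat set) (int_lattice :: (real ^ 'n) set)"
    by (rule int_lattice_enum)
  have el: "e j \<in> int_lattice" for j using bij_betw_imp_surj_on[OF e] by blast
  have d: "decays (\<lambda>x. g x * p x)" by (rule decays_mult_bounded[OF assms(1) p])
  have sm: "summable (\<lambda>j. \<bar>f (x + e j)\<bar>)" if f: "decays f" and x: "x \<in> cube" for f :: "real ^ 'n \<Rightarrow> real" and x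
  proof -
    obtain M where M: "M summable_on (int_lattice :: (real ^ 'n) set)"
      "\<And>m x. m \<in> int_lattice \<Longrightarrow> x \<in> closed_cube \<Longrightarrow> \<bar>f (x + m)\<bar> \<le> M m"
      using decays_lattice_bound[OF f] by blast
    have "(\<lambda>j. M (e j)) summable_on UNIV"
      using summable_on_reindex_bij_betw[OF e] M(1) by blast
    then have "summable (\<lambda>j. M (e j))" by (rule summable_on_imp_summable)
    then show ?thesis
      by (rule summable_comparison_test') (use M(2) el x cube_subset_closed_cube in auto)
  qed
  have "(LINT x|lborel. g x * p x) = (LINT x|lborel. indicator cube x * (\<Sum>j. g (x + e j) * p (x + e j)))"
    by (rule integral_periodize[OF e decays_measurable[OF d] decays_integrable[OF d] sm[OF d]])
  also have "\<dots> = (LINT x:cube|lborel. periodize g x * p x)"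
    unfolding set_lebesgue_integral_def
  proof (rule Bochner_Integration.integral_cong[OF refl])
    fix x :: "real ^ 'n"
    show "indicator cube x * (\<Sum>j. g (x + e j) * p (x + e j)) = indicator cube x *\<^sub>R (periodize g x * p x)"
    proof (cases "x \<in> cube")
      case True
      have s: "summable (\<lambda>j. g (x + e j))" by (rule summable_rabs_cancel[OF sm[OF assms(1) True]])
      have "(\<Sum>j. g (x + e j) * p (x + e j)) = (\<Sum>j. g (x + e j)) * p x"
        by (simp only: per[OF el] suminf_mult2[OF s])
      also have "(\<Sum>j. g (x + e j)) = periodize g x"
        unfolding periodize_def infsum_eq_suminf[OF sm[OF assms(1) True], symmetric]
        by (rule infsum_reindex_bij_betw[OF e])
      finally show ?thesis by simp
    qed simp
  qed
  finally show ?thesis .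
qed

section \<open>Poisson summation under a sign condition\<close>

lemma integral_cube_1: "(LINT x:(cube :: (real ^ 'n) set)|lborel. 1 :: real) = 1"
proof -
  let ?l = "\<chi> i :: 'n. - (1/2 :: real)" and ?u = "\<chi> i :: 'n. (1/2 :: real)"
  have b: "\<exists>i. b = axis i 1" if "b \<in> Basis" for b :: "real ^ 'n"
    using that by (auto simp: Basis_vec_def)
  have le: "\<forall>b\<in>Basis. ?l \<bullet> b \<le> ?u \<bullet> b"
    using b by (force simp: inner_axis)
  have pr: "(\<Prod>b\<in>Basis. (?u - ?l) \<bullet> b) = 1"
    using b by (intro prod.neutral) (force simp: inner_axis)
  have "measure lborel (box ?l ?u) = 1" "measure lborel (cbox ?l ?u) = 1"
    unfolding measure_lborel_box_eq measure_lborel_cbox_eq using le pr by auto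
  moreover have cf: "cube \<in> fmeasurable (lborel :: (real ^ 'n) measure)"
    using emeasure_cube_finite by (auto intro: fmeasurableI)
  moreover have "measure lborel (box ?l ?u) \<le> measure lborel (cube :: (real ^ 'n) set)"
    by (rule measure_mono_fmeasurable[OF _ _ cf]) (auto simp: cube_def mem_box_cart less_imp_le)
  moreover have "measure lborel (cube :: (real ^ 'n) set) \<le> measure lborel (cbox ?l ?u)"
    by (rule measure_mono_fmeasurable) (use cube_subset_cbox in auto)
  ultimately have "measure lborel (cube :: (real ^ 'n) set) = 1" by linarith
  then show ?thesis
    by (simp add: set_lebesgue_integral_def)
qed

lemma set_integrable_cube:
  fixes f :: "real ^ 'n \<Rightarrow> real"
  assumes "continuous_on closed_cube f"
  shows "set_integrable lborel cube f"
proof (rule set_integrable_subset)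
  show "set_integrable lborel closed_cube f"
    using borel_integrable_compact[OF compact_closed_cube assms] by (simp add: set_integrable_def)
qed (use cube_subset_closed_cube in auto)

lemma cos_lattice_periodic:
  assumes "k \<in> int_lattice" "m \<in> int_lattice"
  shows "cos (2 * pi * (k \<bullet> (x + m))) = cos (2 * pi * (k \<bullet> x))"
proof -
  obtain n where n: "k \<bullet> m = of_int n"
    using int_lattice_inner[OF assms] by (auto elim: Ints_cases)
  have "2 * pi * (k \<bullet> (x + m)) = 2 * pi * (k \<bullet> x) + 2 * pi * of_int n"
    by (simp add: inner_add_right distrib_left n)
  then show ?thesis by (simp add: cos_add)
qed

text \<open>Translation by a vector \<open>v\<close> with \<open>k \<bullet> v = 1/2\<close>
  reverses the sign of the cosine, while the integral of a periodic function over a fundamental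
  domain is unchanged by translating the domain. The integral therefore equals its own
  negative.\<close>

lemma integral_cube_cos:
  fixes k :: "real ^ 'n"
  assumes k: "k \<in> int_lattice" "k \<noteq> 0"
  shows "(LINT x:cube|lborel. cos (2 * pi * (k \<bullet> x))) = 0"
proof -
  obtain i where i: "k $ i \<noteq> 0" using k(2) by (auto simp: vec_eq_iff)
  define v :: "real ^ 'n" where "v = axis i (1 / (2 * k $ i))"
  have kv: "k \<bullet> v = 1/2" using i by (simp add: v_def inner_axis)
  define p where "p = (\<lambda>x. cos (2 * pi * (k \<bullet> x)))"
  have pv: "p (x + v) = - p x" for x
    by (simp add: p_def inner_add_right kv distrib_left)
  have pm: "p (x + m) = p x" if "m \<in> int_lattice" for x m
    using cos_lattice_periodic[OF k(1) that] by (simp add: p_def)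
  have pc: "continuous_on S p" for S unfolding p_def by (intro continuous_intros)
  have [measurable]: "p \<in> borel_measurable borel"
    using pc by (rule borel_measurable_continuous_onI)
  \<comment> \<open>\<open>G\<close> is the cosine restricted to the shifted cube. Its lattice
    translates tile as well, so periodizing \<open>G\<close> recovers \<open>p\<close>.\<close>
  define G where "G = (\<lambda>x. indicator cube (x - v) * p x)"
  have [measurable]: "G \<in> borel_measurable borel" unfolding G_def by measurable
  have Gv: "G (x + v) = - (indicator cube x * p x)" for x
    by (simp add: G_def pv)
  have Ic: "integrable lborel (\<lambda>x. indicator cube x * p x)"
    using set_integrable_cube[OF pc] by (simp add: set_integrable_def)
  have IG: "integrable lborel G"
  proof -
    have "integrable lborel (\<lambda>x. G (v + x))" using Ic Gv by (simp add: add.commute)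
    then have "integrable (distr lborel borel ((+) v)) G"
      by (subst integrable_distr_eq) auto
    then show ?thesis by (simp add: lborel_distr_plus)
  qed
  obtain e where e: "bij_betw e (UNIV :: nat set) (int_lattice :: (real ^ 'n) set)"
    by (rule int_lattice_enum)
  have el: "e j \<in> int_lattice" for j using bij_betw_imp_surj_on[OF e] by blast
  have "bij_betw uminus (int_lattice :: (real ^ 'n) set) int_lattice"
    by (rule bij_betwI[where g = uminus]) (auto simp: int_lattice_uminus)
  then have e': "bij_betw (\<lambda>j. - e j) UNIV (int_lattice :: (real ^ 'n) set)"
    using bij_betw_trans[OF e] by (simp add: o_def)
  have Ge: "G (x + e j) = indicator cube ((x - v) - (- e j)) * p x" for x j
    by (simp add: G_def pm[OF el] algebra_simps)
  have Gs: "(\<lambda>j. G (x + e j)) sums p x" for x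
    unfolding Ge by (rule sums_indicator_cube[OF e'])
  have Gs': "(\<lambda>j. \<bar>G (x + e j)\<bar>) sums \<bar>p x\<bar>" for x
    unfolding Ge abs_mult abs_indicator by (rule sums_indicator_cube[OF e'])
  have "(LINT x|lborel. G x) = (LINT x|lborel. indicator cube x * (\<Sum>j. G (x + e j)))"
    by (rule integral_periodize[OF e _ IG]) (use Gs' sums_summable in auto)
  also have "\<dots> = (LINT x|lborel. indicator cube x * p x)"
    by (simp only: sums_unique[OF Gs, symmetric])
  finally have "(LINT x|lborel. indicator cube x * p x) = (LINT x|lborel. G (x + v))"
    by (simp add: lborel_integral_translate)
  then have "(LINT x|lborel. indicator cube x * p x) = - (LINT x|lborel. indicator cube x * p x)"
    by (simp add: Gv)
  then show ?thesis by (simp add: set_lebesgue_integral_def p_def)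
qed

text \<open>
  Cosine polynomials with nonnegative coefficients. An inequality between linear functionals of
  the polynomial has to be checked on single cosines only, so coefficients never appear.
\<close>

inductive pos_trig :: "(real ^ 'n \<Rightarrow> real) \<Rightarrow> bool" where
  cos: "k \<in> int_lattice \<Longrightarrow> pos_trig (\<lambda>x. cos (2 * pi * (k \<bullet> x)))"
| add: "pos_trig p \<Longrightarrow> pos_trig q \<Longrightarrow> pos_trig (\<lambda>x. p x + q x)"
| scale: "c \<ge> 0 \<Longrightarrow> pos_trig p \<Longrightarrow> pos_trig (\<lambda>x. c * p x)"

lemma pos_trig_1: "pos_trig (\<lambda>x. 1)"
  using pos_trig.cos[of 0] by simp

lemma pos_trig_0: "pos_trig (\<lambda>x. 0)"
  using pos_trig.scale[OF _ pos_trig_1, of 0] by simp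

lemma pos_trig_sum: "(\<And>i. i \<in> A \<Longrightarrow> pos_trig (f i)) \<Longrightarrow> pos_trig (\<lambda>x. \<Sum>i\<in>A. f i x)"
  by (induction A rule: infinite_finite_induct) (auto intro: pos_trig_0 pos_trig.add)

lemma cos_mult_cos_inner:
  "cos (2 * pi * (k \<bullet> x)) * cos (2 * pi * (j \<bullet> x)) =
      (1/2) * (cos (2 * pi * ((k - j) \<bullet> x)) + cos (2 * pi * ((k + j) \<bullet> x)))"
  unfolding cos_times_cos
  by (simp only: inner_diff_left inner_add_left right_diff_distrib distrib_left) simp

text \<open>The product-to-sum formula has coefficients \<open>1/2\<close> and frequencies
  \<open>k - j\<close> and \<open>k + j\<close>, so nonnegativity of the coefficients survives
  multiplication. This is what admits all powers of \<open>cos_kernel\<close>.\<close>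

lemma pos_trig_mult_cos:
  assumes "k \<in> int_lattice" "pos_trig q"
  shows "pos_trig (\<lambda>x. cos (2 * pi * (k \<bullet> x)) * q x)"
  using assms(2)
proof induction
  case (cos j)
  have "pos_trig (\<lambda>x. (1/2) * (cos (2 * pi * ((k - j) \<bullet> x)) + cos (2 * pi * ((k + j) \<bullet> x))))"
    using assms(1) cos by (intro pos_trig.scale pos_trig.add pos_trig.cos int_lattice_diff int_lattice_add) auto
  then show ?case by (simp only: cos_mult_cos_inner)
next
  case (add p q)
  then show ?case using pos_trig.add by (fastforce simp: distrib_left)
next
  case (scale c p)
  then show ?case using pos_trig.scale[of c] by (fastforce simp: mult.left_commute)
qed

lemma pos_trig_mult:
  assumes "pos_trig p" "pos_trig q"
  shows "pos_trig (\<lambda>x. p x * q x)"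
  using assms(1)
proof induction
  case (cos k)
  then show ?case using pos_trig_mult_cos[OF _ assms(2)] by blast
next
  case (add p p')
  then show ?case using pos_trig.add by (fastforce simp: distrib_right)
next
  case (scale c p)
  then show ?case using pos_trig.scale[of c] by (fastforce simp: mult.assoc)
qed

lemma pos_trig_power: "pos_trig p \<Longrightarrow> pos_trig (\<lambda>x. p x ^ N)"
  by (induction N) (auto intro: pos_trig_1 pos_trig_mult)

lemma pos_trig_cos_kernel: "pos_trig cos_kernel"
  unfolding cos_kernel_def[abs_def]
  by (intro pos_trig.scale pos_trig_sum pos_trig.add pos_trig_1 pos_trig.cos) auto

lemma pos_trig_continuous: "pos_trig p \<Longrightarrow> continuous_on S p"
  by (induction rule: pos_trig.induct) (auto intro!: continuous_intros)

lemma pos_trig_periodic: "pos_trig p \<Longrightarrow> m \<in> int_lattice \<Longrightarrow> p (x + m) = p x"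
  by (induction rule: pos_trig.induct) (auto simp: cos_lattice_periodic)

lemma pos_trig_bounded: "pos_trig p \<Longrightarrow> \<exists>B. \<forall>x. \<bar>p x\<bar> \<le> B"
proof (induction rule: pos_trig.induct)
  case (cos k)
  show ?case by (rule exI[of _ 1]) auto
next
  case (add p q)
  then obtain A B where "\<And>x. \<bar>p x\<bar> \<le> A" "\<And>x. \<bar>q x\<bar> \<le> B" by blast
  then have "\<bar>p x + q x\<bar> \<le> A + B" for x by (meson abs_triangle_ineq add_mono order_trans)
  then show ?case by blast
next
  case (scale c p)
  then obtain A where "\<And>x. \<bar>p x\<bar> \<le> A" by blast
  then have "\<bar>c * p x\<bar> \<le> c * A" for x using scale(1) by (simp add: abs_mult mult_left_mono)
  then show ?case by blast
qed

text \<open>The real part of the Fourier transform, written without complex numbers. The frequency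
  is an arbitrary vector, since half-integral ones are needed later.\<close>

definition cos_transform :: "(real ^ 'n \<Rightarrow> real) \<Rightarrow> real ^ 'n \<Rightarrow> real" where
  "cos_transform g k = (LINT x|lborel. g x * cos (2 * pi * (k \<bullet> x)))"

text \<open>Expanding \<open>p\<close> into cosines turns the left side into a combination of values
  of \<open>cos_transform g\<close> with nonnegative weights. The two integrals over
  \<open>cube\<close> extract the weights of the frequencies \<open>0\<close> and \<open>k\<close>,
  \<open>- k\<close>; every other frequency contributes a nonpositive term on the left and nothing
  on the right.\<close>

lemma integral_mult_pos_trig_le:
  fixes g :: "real ^ 'n \<Rightarrow> real"
  assumes g: "decays g" and neg: "\<And>j. j \<in> int_lattice \<Longrightarrow> j \<noteq> 0 \<Longrightarrow> cos_transform g j \<le> 0"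
    and k: "k \<in> int_lattice" "k \<noteq> 0" and p: "pos_trig p"
  shows "(LINT x|lborel. g x * p x) \<le> cos_transform g 0 * (LINT x:cube|lborel. p x)
     + 2 * cos_transform g k * (LINT x:cube|lborel. cos (2 * pi * (k \<bullet> x)) * p x)"
  using p
proof induction
  case (cos j)
  have cc: "(LINT x:cube|lborel. cos (2 * pi * (k \<bullet> x)) * cos (2 * pi * (j \<bullet> x))) =
      (LINT x:cube|lborel. cos (2 * pi * ((k - j) \<bullet> x))) / 2 + (LINT x:cube|lborel. cos (2 * pi * ((k + j) \<bullet> x))) / 2"
  proof -
    have "(\<lambda>x. cos (2 * pi * (k \<bullet> x)) * cos (2 * pi * (j \<bullet> x))) =
      (\<lambda>x. cos (2 * pi * ((k - j) \<bullet> x)) / 2 + cos (2 * pi * ((k + j) \<bullet> x)) / 2)"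
      by (simp add: fun_eq_iff cos_mult_cos_inner add_divide_distrib)
    then show ?thesis
      by (simp only:) (subst set_integral_add(2), auto intro!: set_integrable_cube continuous_intros)
  qed
  have kj: "k - j \<in> int_lattice" "k + j \<in> int_lattice"
    using k cos int_lattice_diff int_lattice_add by auto
  have sym: "cos_transform g (- k) = cos_transform g k"
    by (simp add: cos_transform_def)
  consider "j = 0" | "j = k" | "j = - k" | "j \<noteq> 0" "j \<noteq> k" "j \<noteq> - k" by blast
  then show ?case
  proof cases
    case 1
    then show ?thesis using integral_cube_cos[OF k] by (simp add: cos_transform_def integral_cube_1)
  next
    case 2
    \<comment> \<open>Hence the doubled frequency integrates to \<open>0\<close> and the squared
      cosine to \<open>1/2\<close>, which cancels the factor \<open>2\<close>.\<close>
    have "k + k \<noteq> 0" using k(2) by (simp add: vec_eq_iff)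
    then show ?thesis
      using integral_cube_cos[OF k] integral_cube_cos[OF kj(2)] 2
      unfolding cc by (simp add: cos_transform_def integral_cube_1)
  next
    case 3
    have "k + k \<noteq> 0" using k(2) by (simp add: vec_eq_iff)
    then show ?thesis
      using integral_cube_cos[OF k] integral_cube_cos[OF kj(1)] 3
      unfolding cc by (simp add: cos_transform_def integral_cube_1)
  next
    case 4
    have "k - j \<noteq> 0" using 4 by auto
    moreover have "k + j \<noteq> 0" using 4 by (metis add.inverse_unique minus_minus)
    ultimately have "(LINT x:cube|lborel. cos (2 * pi * (k \<bullet> x)) * cos (2 * pi * (j \<bullet> x))) = 0"
      unfolding cc using integral_cube_cos[OF kj(1)] integral_cube_cos[OF kj(2)] by simp
    then show ?thesis
      using integral_cube_cos[OF cos 4(1)] neg[OF cos 4(1)] by (simp add: cos_transform_def)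
  qed
next
  case (add p q)
  have i: "integrable lborel (\<lambda>x. g x * r x)" if "pos_trig r" for r
    using pos_trig_bounded[OF that] pos_trig_continuous[OF that] decays_mult_bounded[OF g] decays_integrable
    by metis
  have c: "set_integrable lborel cube r" "set_integrable lborel cube (\<lambda>x. cos (2 * pi * (k \<bullet> x)) * r x)"
    if "pos_trig r" for r
    using pos_trig_continuous[OF that] by (auto intro!: set_integrable_cube continuous_intros)
  show ?case
    using add.IH i[OF add.hyps(1)] i[OF add.hyps(2)] c[OF add.hyps(1)] c[OF add.hyps(2)]
    by (simp add: distrib_left set_integral_add)
next
  case (scale c p)
  have "c * (LINT x|lborel. g x * p x) \<le> c * (cos_transform g 0 * (LINT x:cube|lborel. p x)
     + 2 * cos_transform g k * (LINT x:cube|lborel. cos (2 * pi * (k \<bullet> x)) * p x))"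
    using scale by (intro mult_left_mono) auto
  then show ?case
    by (simp add: mult.left_commute[of _ c] distrib_left)
qed

lemma kernel_concentrates:
  fixes \<phi> :: "real ^ 'n \<Rightarrow> real"
  assumes "continuous_on closed_cube \<phi>"
  shows "(\<lambda>N. (LINT x:cube|lborel. \<phi> x * cos_kernel x ^ N) / (LINT x:(cube :: (real ^ 'n) set)|lborel. cos_kernel x ^ N)) \<longlonglongrightarrow> \<phi> 0"
  by (rule power_kernel_concentrates(1)[where K = "closed_cube :: (real ^ 'n) set" and a = 0 and T = cos_kernel and \<phi> = \<phi> and C = cube],
      (rule compact_closed_cube sets_cube cube_subset_closed_cube zero_closed_cube measure_cube_ball_pos continuous_cos_kernel
        cos_kernel_nonneg cos_kernel_0 cos_kernel_less_1 assms | assumption)+)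

lemma integral_cos_kernel_pos: "(LINT x:(cube :: (real ^ 'n) set)|lborel. cos_kernel x ^ N) > 0"
  by (rule power_kernel_concentrates(2)[where K = "closed_cube :: (real ^ 'n) set" and a = 0 and \<phi> = "\<lambda>_. 0"],
      (rule compact_closed_cube sets_cube cube_subset_closed_cube zero_closed_cube measure_cube_ball_pos continuous_cos_kernel
        cos_kernel_nonneg cos_kernel_0 cos_kernel_less_1 continuous_on_const | assumption)+)

text \<open>The factor \<open>2\<close> accounts for the frequencies \<open>k\<close> and \<open>- k\<close>.\<close>

theorem poisson_upper_bound:
  fixes g :: "real ^ 'n \<Rightarrow> real"
  assumes g: "decays g" and neg: "\<And>j. j \<in> int_lattice \<Longrightarrow> j \<noteq> 0 \<Longrightarrow> cos_transform g j \<le> 0"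
    and k: "k \<in> int_lattice" "k \<noteq> 0"
  shows "(\<Sum>\<^sub>\<infinity>m\<in>int_lattice. g m) \<le> cos_transform g 0 + 2 * cos_transform g k"
proof -
  define c where "c = (\<lambda>N. LINT x:(cube :: (real ^ 'n) set)|lborel. cos_kernel x ^ N)"
  have c: "c N > 0" for N unfolding c_def by (rule integral_cos_kernel_pos)
  have T: "pos_trig (\<lambda>x :: real ^ 'n. cos_kernel x ^ N)" for N
    by (rule pos_trig_power[OF pos_trig_cos_kernel])
  have eq: "(LINT x|lborel. g x * cos_kernel x ^ N) = (LINT x:cube|lborel. periodize g x * cos_kernel x ^ N)" for N
  proof -
    obtain B where "\<And>x :: real ^ 'n. \<bar>cos_kernel x ^ N\<bar> \<le> B"
      using pos_trig_bounded[OF T] by blast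
    then show ?thesis
      by (rule integral_mult_periodic[OF g pos_trig_continuous[OF T]]) (rule pos_trig_periodic[OF T])
  qed
  \<comment> \<open>The normalized kernel evaluates \<open>periodize g\<close> at \<open>0\<close>;
    applied to \<open>cos (2 * pi * (k \<bullet> x))\<close> it gives \<open>1\<close>, so the
    weight of the retained frequency tends to its full value.\<close>
  have lim1: "(\<lambda>N. (LINT x|lborel. g x * cos_kernel x ^ N) / c N) \<longlonglongrightarrow> (\<Sum>\<^sub>\<infinity>m\<in>int_lattice. g m)"
    using kernel_concentrates[OF continuous_periodize[OF g]] unfolding eq c_def by (simp add: periodize_def)
  have "(\<lambda>N. (LINT x:cube|lborel. cos (2 * pi * (k \<bullet> x)) * cos_kernel x ^ N) / c N) \<longlonglongrightarrow> cos (2 * pi * (k \<bullet> 0))"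
    unfolding c_def by (rule kernel_concentrates) (intro continuous_intros)
  then have lim2: "(\<lambda>N. cos_transform g 0 + 2 * cos_transform g k *
      ((LINT x:cube|lborel. cos (2 * pi * (k \<bullet> x)) * cos_kernel x ^ N) / c N))
      \<longlonglongrightarrow> cos_transform g 0 + 2 * cos_transform g k * 1"
    by (intro tendsto_add tendsto_mult tendsto_const) simp
  have "(LINT x|lborel. g x * cos_kernel x ^ N) / c N \<le> cos_transform g 0 + 2 * cos_transform g k *
      ((LINT x:cube|lborel. cos (2 * pi * (k \<bullet> x)) * cos_kernel x ^ N) / c N)" for N
  proof -
    have "(LINT x|lborel. g x * cos_kernel x ^ N) / c N \<le> (cos_transform g 0 * c N + 2 * cos_transform g k *
      (LINT x:cube|lborel. cos (2 * pi * (k \<bullet> x)) * cos_kernel x ^ N)) / c N"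
      using integral_mult_pos_trig_le[OF g neg k T[of N]] c[of N] unfolding c_def
      by (intro divide_right_mono) auto
    then show ?thesis using c[of N] by (simp add: add_divide_distrib)
  qed
  then show ?thesis using LIMSEQ_le[OF lim1 lim2] by simp
qed

text \<open>The one-sided bound applies to both \<open>g\<close> and \<open>- g\<close>, and the
  retained term is zero, so any nonzero lattice vector can serve as \<open>k\<close>.\<close>

corollary poisson_vanishing:
  fixes g :: "real ^ 'n \<Rightarrow> real"
  assumes g: "decays g" and zero: "\<And>j. j \<in> int_lattice \<Longrightarrow> j \<noteq> 0 \<Longrightarrow> cos_transform g j = 0"
  shows "(\<Sum>\<^sub>\<infinity>m\<in>int_lattice. g m) = cos_transform g 0"
proof -
  obtain i :: 'n where True by blast
  have k: "axis i 1 \<in> (int_lattice :: (real ^ 'n) set)" "axis i 1 \<noteq> (0 :: real ^ 'n)"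
    by (auto simp: axis_eq_0_iff)
  have d: "decays (\<lambda>x. - g x)"
    using g by (auto simp: decays_def intro!: continuous_intros)
  have n: "cos_transform (\<lambda>x. - g x) j = - cos_transform g j" for j
    by (simp add: cos_transform_def)
  have "(\<Sum>\<^sub>\<infinity>m\<in>int_lattice. g m) \<le> cos_transform g 0"
    using poisson_upper_bound[OF g _ k] zero zero[OF k] by simp
  moreover have "(\<Sum>\<^sub>\<infinity>m\<in>int_lattice. - g m) \<le> - cos_transform g 0"
    using poisson_upper_bound[OF d _ k] zero zero[OF k] by (simp add: n)
  ultimately show ?thesis by (simp add: infsum_uminus)
qed

section \<open>Orthogonal changes of variable\<close>

text \<open>
  Multiply by the integral of the indicator \<open>b\<close> of the unit ball, which is invariant under \<open>f\<close>; the
  resulting double integral is transformed by translations and reflections only.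
\<close>

lemma nn_integral_orthogonal_transformation:
  fixes f :: "'a :: euclidean_space \<Rightarrow> 'a" and F :: "'a \<Rightarrow> ennreal"
  assumes f: "orthogonal_transformation f" and [measurable]: "F \<in> borel_measurable borel"
  shows "(\<integral>\<^sup>+ x. F (f x) \<partial>lborel) = (\<integral>\<^sup>+ x. F x \<partial>lborel)"
proof -
  have lin: "linear f" using f by (rule orthogonal_transformation_linear)
  have [measurable]: "f \<in> borel_measurable borel"
    using lin by (intro borel_measurable_continuous_onI linear_continuous_on linear_conv_bounded_linear[THEN iffD1])
  define b :: "'a \<Rightarrow> ennreal" where "b = indicator (ball 0 1)"
  have [measurable]: "b \<in> borel_measurable borel" unfolding b_def by (rule borel_measurable_indicator) simp
  have bf: "b (f x) = b x" for x
    using orthogonal_transformation_norm[OF f, of x] by (simp add: b_def indicator_def)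
  define V where "V = (\<integral>\<^sup>+ y. b y \<partial>(lborel :: 'a measure))"
  have V: "V = emeasure lborel (ball (0 :: 'a) 1)" by (simp add: V_def b_def)
  have refl: "(\<integral>\<^sup>+ y. F (c - y) \<partial>lborel) = (\<integral>\<^sup>+ y. F y \<partial>lborel)" for c
  proof -
    have lb: "distr lborel borel uminus = (lborel :: 'a measure)"
      using lborel_affine[of "- 1" "0 :: 'a"] by (simp add: density_1)
    have "(\<integral>\<^sup>+ y. F (c - y) \<partial>lborel) = (\<integral>\<^sup>+ y. F (y + c) \<partial>distr lborel borel uminus)"
      by (subst nn_integral_distr) auto
    then show ?thesis by (simp add: lb lborel_nn_integral_translate)
  qed
  have "(\<integral>\<^sup>+ x. F (f x) \<partial>lborel) * V = (\<integral>\<^sup>+ x. F (f x) * V \<partial>lborel)"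
    by (rule nn_integral_multc[symmetric]) measurable
  also have "\<dots> = (\<integral>\<^sup>+ x. \<integral>\<^sup>+ y. F (f x) * b (y + f x) \<partial>lborel \<partial>lborel)"
  proof (rule nn_integral_cong)
    fix x
    have "V = (\<integral>\<^sup>+ y. b (y + f x) \<partial>lborel)"
      unfolding V_def by (rule lborel_nn_integral_translate[symmetric]) measurable
    then show "F (f x) * V = (\<integral>\<^sup>+ y. F (f x) * b (y + f x) \<partial>lborel)"
      by (simp add: nn_integral_cmult)
  qed
  also have "\<dots> = (\<integral>\<^sup>+ y. \<integral>\<^sup>+ x. F (f x) * b (y + f x) \<partial>lborel \<partial>lborel)"
    by (rule lborel_pair.Fubini') measurable
  also have "\<dots> = (\<integral>\<^sup>+ y. \<integral>\<^sup>+ x. F (f x - y) * b x \<partial>lborel \<partial>lborel)"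
  proof (rule nn_integral_cong)
    fix y :: 'a
    \<comment> \<open>Translating \<open>x\<close> by \<open>- w\<close> moves the shift by
      \<open>y\<close> from the argument of \<open>b\<close> to that of \<open>F\<close>, after
      which invariance of \<open>b\<close> removes \<open>f\<close> from it.\<close>
    obtain w where w: "y = f w" using orthogonal_transformation_surj[OF f] by blast
    have "(\<integral>\<^sup>+ x. F (f x) * b (y + f x) \<partial>lborel) = (\<integral>\<^sup>+ x. F (f (x + (- w))) * b (y + f (x + (- w))) \<partial>lborel)"
      by (rule lborel_nn_integral_translate[symmetric]) measurable
    also have "\<dots> = (\<integral>\<^sup>+ x. F (f x - y) * b x \<partial>lborel)"
      by (rule nn_integral_cong) (simp add: linear_diff[OF lin] w bf)
    finally show "(\<integral>\<^sup>+ x. F (f x) * b (y + f x) \<partial>lborel) = (\<integral>\<^sup>+ x. F (f x - y) * b x \<partial>lborel)" .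
  qed
  also have "\<dots> = (\<integral>\<^sup>+ x. \<integral>\<^sup>+ y. F (f x - y) * b x \<partial>lborel \<partial>lborel)"
    by (rule lborel_pair.Fubini'[symmetric]) measurable
  \<comment> \<open>For fixed \<open>x\<close> the integral over \<open>y\<close> sees
    \<open>f x\<close> only as the centre of a reflection, so \<open>f\<close> disappears.\<close>
  also have "\<dots> = (\<integral>\<^sup>+ x. (\<integral>\<^sup>+ y. F y \<partial>lborel) * b x \<partial>lborel)"
    by (rule nn_integral_cong) (simp add: nn_integral_multc refl)
  also have "\<dots> = (\<integral>\<^sup>+ y. F y \<partial>lborel) * V"
    by (simp add: nn_integral_cmult V_def)
  finally have eq: "V * (\<integral>\<^sup>+ x. F (f x) \<partial>lborel) = V * (\<integral>\<^sup>+ y. F y \<partial>lborel)"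
    by (simp add: mult.commute)
  have "emeasure lborel (ball (0 :: 'a) 1) = ennreal (measure lborel (ball (0 :: 'a) 1))"
    using emeasure_lborel_ball_finite[of "0 :: 'a" 1] by (simp add: emeasure_eq_ennreal_measure less_top)
  then have "V \<noteq> 0" "V < top"
    using content_ball_pos[of 1 "0 :: 'a"] unfolding V by auto
  then show ?thesis using eq by (auto simp: ennreal_mult_cancel_left)
qed

lemma integral_orthogonal_transformation:
  fixes f :: "'a :: euclidean_space \<Rightarrow> 'a" and F :: "'a \<Rightarrow> real"
  assumes f: "orthogonal_transformation f" and [measurable]: "F \<in> borel_measurable borel"
  shows "(LINT x|lborel. F (f x)) = (LINT x|lborel. F x)"
proof -
  have [measurable]: "f \<in> borel_measurable borel"
    using orthogonal_transformation_linear[OF f]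
    by (intro borel_measurable_continuous_onI linear_continuous_on linear_conv_bounded_linear[THEN iffD1])
  have "distr lborel borel f = (lborel :: 'a measure)"
  proof (rule measure_eqI)
    fix A assume "A \<in> sets (distr lborel borel f)"
    then have [measurable]: "A \<in> sets borel" by simp
    have "emeasure (distr lborel borel f) A = (\<integral>\<^sup>+ x. indicator A x \<partial>distr lborel borel f)"
      by simp
    also have "\<dots> = (\<integral>\<^sup>+ x. indicator A (f x) \<partial>lborel)"
      by (rule nn_integral_distr) auto
    also have "\<dots> = emeasure lborel A"
      by (subst nn_integral_orthogonal_transformation[OF f]) auto
    finally show "emeasure (distr lborel borel f) A = emeasure lborel A" .
  qed simp
  then have "(LINT x|lborel. F x) = (LINT x|distr lborel borel f. F x)" by simp
  also have "\<dots> = (LINT x|lborel. F (f x))"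
    by (rule integral_distr) auto
  finally show ?thesis by simp
qed

text \<open>This makes the two inequalities for \<open>h\<close> available on every rotated copy of
  the integer lattice. The matrix of \<open>R\<close> is a basis matrix of determinant
  \<open>1\<close> or \<open>- 1\<close>.\<close>

lemma unimodular_integral_orthogonal_image:
  fixes R :: "real ^ 'n \<Rightarrow> real ^ 'n"
  assumes R: "orthogonal_transformation R"
  shows "unimodular_lattice (R ` int_lattice)" "integral_lattice (R ` int_lattice)"
proof -
  have lin: "linear R" using R by (rule orthogonal_transformation_linear)
  have det: "\<bar>det (matrix R)\<bar> = 1" using R by simp
  have b: "lattice_basis (matrix R) (R ` int_lattice)"
    unfolding lattice_basis_def using det lin by (auto simp: invertible_det_nz matrix_works)
  then have l: "is_lattice (R ` int_lattice)" unfolding is_lattice_def by blast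
  show "unimodular_lattice (R ` int_lattice)"
    using l covol_eq[OF b] det by (simp add: unimodular_lattice_def)
  have "R x \<bullet> R y \<in> \<int>" if "x \<in> int_lattice" "y \<in> int_lattice" for x y
    using R int_lattice_inner[OF that] by (simp add: orthogonal_transformation_def)
  then show "integral_lattice (R ` int_lattice)"
    using l by (auto simp: integral_lattice_def)
qed

text \<open>The product weight is at most \<open>(1 + (norm x)\<^sup>2) ^ n\<close>, hence at most
  \<open>2 ^ n * (1 + norm x ^ (2 * n))\<close> with \<open>n\<close> the dimension, so the decay
  bounds for the exponents \<open>0\<close> and \<open>2 * n\<close> suffice.\<close>

lemma decays_rapidly_decreasing:
  fixes h :: "real ^ 'n \<Rightarrow> real"
  assumes cont: "continuous_on UNIV h" and dec: "\<And>k :: nat. \<exists>C. \<forall>x. norm x ^ k * \<bar>h x\<bar> \<le> C"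
  shows "decays h"
proof -
  let ?n = "CARD('n)"
  obtain A where A: "\<And>x. norm x ^ 0 * \<bar>h x\<bar> \<le> A" using dec by blast
  obtain B where B: "\<And>x. norm x ^ (2 * ?n) * \<bar>h x\<bar> \<le> B" using dec by blast
  have "\<bar>h x\<bar> * (\<Prod>i\<in>UNIV. 1 + (x $ i)\<^sup>2) \<le> 2 ^ ?n * (A + B)" for x
  proof -
    have "(\<Prod>i\<in>UNIV. 1 + (x $ i)\<^sup>2) \<le> (\<Prod>i\<in>(UNIV :: 'n set). 1 + (norm x)\<^sup>2)"
    proof (rule prod_mono)
      show "0 \<le> 1 + (x $ i)\<^sup>2 \<and> 1 + (x $ i)\<^sup>2 \<le> 1 + (norm x)\<^sup>2" for i
        using power_mono[OF component_le_norm_cart[of x i], of 2] by simp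
    qed
    also have "\<dots> = (1 + (norm x)\<^sup>2) ^ ?n" by simp
    also have "\<dots> \<le> 2 ^ ?n * (1 + norm x ^ (2 * ?n))"
    proof (cases "norm x \<le> 1")
      case True
      then have "(norm x)\<^sup>2 \<le> 1" by (simp add: power_le_one)
      then have "(1 + (norm x)\<^sup>2) ^ ?n \<le> 2 ^ ?n" by (intro power_mono) auto
      also have "\<dots> \<le> 2 ^ ?n * (1 + norm x ^ (2 * ?n))" by simp
      finally show ?thesis .
    next
      case False
      then have "1 \<le> (norm x)\<^sup>2" by (simp add: one_le_power)
      then have "(1 + (norm x)\<^sup>2) ^ ?n \<le> (2 * (norm x)\<^sup>2) ^ ?n" by (intro power_mono) auto
      also have "\<dots> = 2 ^ ?n * norm x ^ (2 * ?n)" by (simp add: power_mult_distrib power_mult)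
      also have "\<dots> \<le> 2 ^ ?n * (1 + norm x ^ (2 * ?n))" by simp
      finally show ?thesis .
    qed
    finally have "\<bar>h x\<bar> * (\<Prod>i\<in>UNIV. 1 + (x $ i)\<^sup>2) \<le> \<bar>h x\<bar> * (2 ^ ?n * (1 + norm x ^ (2 * ?n)))"
      by (rule mult_left_mono) simp
    also have "\<dots> = 2 ^ ?n * (norm x ^ 0 * \<bar>h x\<bar> + norm x ^ (2 * ?n) * \<bar>h x\<bar>)"
      by (simp add: algebra_simps)
    also have "\<dots> \<le> 2 ^ ?n * (A + B)"
      by (intro mult_left_mono add_mono A B) auto
    finally show ?thesis .
  qed
  then show ?thesis using cont unfolding decays_def by blast
qed

section \<open>Schwartz functions and their transforms under rotation\<close>

lemma schwartz_rapidly_decreasing: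
  fixes h :: "real ^ 'n \<Rightarrow> real"
  assumes h: "schwartz h"
  shows "continuous_on UNIV h" "\<exists>C. \<forall>x. norm x ^ k * \<bar>h x\<bar> \<le> C"
proof -
  have "iterated_partial [] h differentiable (at x)" for x
    using h unfolding schwartz_def by blast
  then show "continuous_on UNIV h"
    by (auto intro!: continuous_at_imp_continuous_on differentiable_imp_continuous_within)
  have "\<exists>C. \<forall>x. norm x ^ k * norm (iterated_partial [] h x) \<le> C"
    using h unfolding schwartz_def by blast
  then show "\<exists>C. \<forall>x. norm x ^ k * \<bar>h x\<bar> \<le> C" by simp
qed

lemma decays_schwartz_orthogonal:
  fixes h :: "real ^ 'n \<Rightarrow> real" and R :: "real ^ 'n \<Rightarrow> real ^ 'n"
  assumes h: "schwartz h" and R: "orthogonal_transformation R"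
  shows "decays (\<lambda>x. h (R x))"
proof (rule decays_rapidly_decreasing)
  show "continuous_on UNIV (\<lambda>x. h (R x))"
    using orthogonal_transformation_linear[OF R]
    by (intro continuous_on_compose2[OF schwartz_rapidly_decreasing(1)[OF h]] linear_continuous_on)
      (auto simp: linear_conv_bounded_linear)
  fix k :: nat
  obtain C where C: "\<And>x. norm x ^ k * \<bar>h x\<bar> \<le> C" using schwartz_rapidly_decreasing(2)[OF h] by blast
  have "norm x ^ k * \<bar>h (R x)\<bar> \<le> C" for x
    using C[of "R x"] orthogonal_transformation_norm[OF R, of x] by simp
  then show "\<exists>C. \<forall>x. norm x ^ k * \<bar>h (R x)\<bar> \<le> C" by blast
qed

lemma real_fourier_eq_cos_transform:
  fixes h :: "real ^ 'n \<Rightarrow> real"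
  assumes "decays h"
  shows "real_fourier h \<xi> = cos_transform h \<xi>"
proof -
  have [measurable]: "h \<in> borel_measurable borel" using assms by (rule decays_measurable)
  have "integrable lborel (\<lambda>x. complex_of_real (h x) * exp (- 2 * of_real pi * \<i> * of_real (x \<bullet> \<xi>)))"
  proof (rule Bochner_Integration.integrable_bound[OF decays_integrable[OF assms]])
    have "norm (exp (- 2 * of_real pi * \<i> * of_real (x \<bullet> \<xi>))) = 1" for x
      by (simp add: norm_exp_eq_Re)
    then show "AE x in lborel. norm (complex_of_real (h x) * exp (- 2 * of_real pi * \<i> * of_real (x \<bullet> \<xi>))) \<le> norm (h x)"
      by (simp add: norm_mult)
  qed measurable
  then have "real_fourier h \<xi> = (LINT x|lborel. Re (complex_of_real (h x) * exp (- 2 * of_real pi * \<i> * of_real (x \<bullet> \<xi>))))"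
    unfolding real_fourier_def fourier_transform_def by (rule integral_Re[symmetric])
  also have "\<dots> = cos_transform h \<xi>"
    unfolding cos_transform_def
    by (rule Bochner_Integration.integral_cong) (simp_all add: Re_exp inner_commute mult.assoc)
  finally show ?thesis .
qed

text \<open>Since \<open>R k \<bullet> R x = k \<bullet> x\<close>, Poisson summation of
  \<open>h\<close> over a rotated lattice becomes summation of the rotated function over
  \<open>int_lattice\<close>.\<close>

lemma cos_transform_orthogonal:
  fixes h :: "real ^ 'n \<Rightarrow> real" and R :: "real ^ 'n \<Rightarrow> real ^ 'n"
  assumes h: "decays h" and R: "orthogonal_transformation R"
  shows "cos_transform (\<lambda>x. h (R x)) k = cos_transform h (R k)"
proof -
  have [measurable]: "h \<in> borel_measurable borel" using h by (rule decays_measurable)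
  have "cos_transform (\<lambda>x. h (R x)) k = (LINT x|lborel. (\<lambda>y. h y * cos (2 * pi * (R k \<bullet> y))) (R x))"
    using R by (simp add: cos_transform_def orthogonal_transformation_def)
  also have "\<dots> = cos_transform h (R k)"
    unfolding cos_transform_def by (rule integral_orthogonal_transformation[OF R]) measurable
  finally show ?thesis .
qed

section \<open>Half-integral vectors\<close>

text \<open>For \<open>U = {}\<close> this is membership in \<open>int_lattice\<close>, the end of a
  descent that removes four elements of \<open>U\<close> at a time.\<close>

definition half_integral_on :: "'n set \<Rightarrow> real ^ 'n \<Rightarrow> bool" where
  "half_integral_on U x \<longleftrightarrow> (\<forall>i. (if i \<in> U then x $ i - 1/2 else x $ i) \<in> \<int>)"

text \<open>
  Reflect in a vector \<open>v\<close> with entries \<open>1\<close> or \<open>- 1\<close> on \<open>V\<close> for which \<open>v \<bullet> x\<close> is odd; flipping one sign of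
  \<open>v\<close> changes the parity of \<open>v \<bullet> x\<close>.
\<close>

lemma reflect_four_halves:
  fixes x :: "real ^ 'n"
  assumes V: "card V = 4" "V \<subseteq> U" and x: "half_integral_on U x"
  obtains R where "orthogonal_transformation R" "half_integral_on (U - V) (R x)"
proof -
  have xV: "x $ i - 1/2 \<in> \<int>" if "i \<in> V" for i
    using x V(2) that unfolding half_integral_on_def by (metis subsetD)
  have fin: "finite V" by simp
  have "(\<Sum>i\<in>V. x $ i) = (\<Sum>i\<in>V. x $ i - 1/2) + 2"
    using V(1) by (simp add: sum_subtractf)
  moreover have "(\<Sum>i\<in>V. x $ i - 1/2) \<in> \<int>" using xV by (rule Ints_sum)
  ultimately have "(\<Sum>i\<in>V. x $ i) \<in> \<int>" by simp
  then obtain s where s: "(\<Sum>i\<in>V. x $ i) = of_int s" by (auto elim: Ints_cases)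
  obtain v :: "real ^ 'n" and k :: int where v: "\<And>i. i \<in> V \<Longrightarrow> v $ i = 1 \<or> v $ i = - 1"
      "\<And>i. i \<notin> V \<Longrightarrow> v $ i = 0" and k: "v \<bullet> x = of_int (2 * k + 1)"
  proof (cases "even s")
    case False
    then obtain k where "s = 2 * k + 1" by (auto elim: oddE)
    moreover have "(\<chi> i. if i \<in> V then 1 else 0) \<bullet> x = (\<Sum>i\<in>V. x $ i)"
      by (simp add: inner_vec_def if_distrib[of "\<lambda>a. a * _"] sum.If_cases cong: if_cong)
    ultimately show ?thesis using s by (intro that[of "\<chi> i. if i \<in> V then 1 else 0" k]) auto
  next
    case True
    then obtain l where l: "s = 2 * l" by auto
    obtain a where a: "a \<in> V" using V(1) by fastforce
    obtain m where m: "x $ a - 1/2 = of_int m" using xV[OF a] by (auto elim: Ints_cases)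
    define w :: "real ^ 'n" where "w = (\<chi> i. if i \<in> V then (if i = a then - 1 else 1) else 0)"
    have "w \<bullet> x = (\<Sum>i\<in>V. (if i = a then - 1 else 1) * x $ i)"
      by (simp add: w_def inner_vec_def if_distrib[of "\<lambda>a. a * _"] sum.If_cases cong: if_cong)
    also have "\<dots> = (\<Sum>i\<in>V. x $ i - (if i = a then 2 * x $ i else 0))"
      by (intro sum.cong) auto
    also have "\<dots> = of_int s - 2 * x $ a"
      using a fin by (simp add: sum_subtractf s)
    also have "\<dots> = of_int (2 * (l - m - 1) + 1)"
      using m l by simp
    finally have "w \<bullet> x = of_int (2 * (l - m - 1) + 1)" .
    then show ?thesis by (intro that[of w "l - m - 1"]) (auto simp: w_def)
  qed
  have vv: "v \<bullet> v = 4"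
  proof -
    have "v $ i * v $ i = (if i \<in> V then 1 else 0)" for i
      using v by (cases "i \<in> V") force+
    then show ?thesis using V(1) by (simp add: inner_vec_def sum.If_cases)
  qed
  \<comment> \<open>The usual factor \<open>2 / (v \<bullet> v)\<close> of a reflection is
    \<open>1/2\<close> here.\<close>
  define R where "R = (\<lambda>y. y - ((v \<bullet> y) / 2) *\<^sub>R v)"
  have "orthogonal_transformation R"
    unfolding orthogonal_transformation_def
  proof
    show "linear R"
      by (rule linearI) (simp_all add: R_def inner_add_right algebra_simps add_divide_distrib)
    show "\<forall>y z. R y \<bullet> R z = y \<bullet> z"
      by (simp add: R_def inner_diff_left inner_diff_right vv inner_commute algebra_simps)
  qed
  moreover have "half_integral_on (U - V) (R x)"
    unfolding half_integral_on_def
  proof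
    fix i
    show "(if i \<in> U - V then R x $ i - 1/2 else R x $ i) \<in> \<int>"
    proof (cases "i \<in> V")
      case True
      obtain m where m: "x $ i - 1/2 = of_int m" using xV[OF True] by (auto elim: Ints_cases)
      \<comment> \<open>Oddness of \<open>v \<bullet> x\<close> enters here:
        \<open>(v \<bullet> x) / 2 = k + 1/2\<close> is half-odd, so adding it to or subtracting it
        from a half-odd entry leaves an integer.\<close>
      have "R x $ i = (if v $ i = 1 then of_int (m - k) else of_int (m + k + 1))"
        using v(1)[OF True] m by (auto simp: R_def k field_simps)
      then show ?thesis using True by simp
    next
      case False
      then show ?thesis
        using spec[OF x[unfolded half_integral_on_def], of i] v(2)[OF False] False by (auto simp: R_def split: if_splits)
    qed
  qed
  ultimately show ?thesis by (rule that)
qed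

text \<open>Each reflection clears one block of four half-odd entries; the inverse of the composite
  carries the resulting lattice vector back to \<open>x\<close>.\<close>

lemma half_integral_rotates_to_lattice:
  fixes x :: "real ^ 'n"
  assumes "card U = 4 * j" "half_integral_on U x"
  obtains R :: "real ^ 'n \<Rightarrow> real ^ 'n" and z where "orthogonal_transformation R" "z \<in> int_lattice" "x = R z"
proof -
  have "\<exists>R :: real ^ 'n \<Rightarrow> real ^ 'n. orthogonal_transformation R \<and> R x \<in> int_lattice"
    using assms
  proof (induction j arbitrary: U x)
    case 0
    then have "x \<in> int_lattice" by (auto simp: half_integral_on_def int_lattice_def)
    then show ?case using orthogonal_transformation_id by blast
  next
    case (Suc j)
    obtain V where V: "V \<subseteq> U" "card V = 4"
      using obtain_subset_with_card_n[of 4 U] Suc.prems(1) by auto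
    obtain R where R: "orthogonal_transformation R" "half_integral_on (U - V) (R x)"
      using reflect_four_halves[OF V(2,1) Suc.prems(2)] by blast
    have "card (U - V) = 4 * j" using V Suc.prems(1) by (simp add: card_Diff_subset finite_subset)
    then obtain S :: "real ^ 'n \<Rightarrow> real ^ 'n" where S: "orthogonal_transformation S" "S (R x) \<in> int_lattice"
      using Suc.IH R(2) by blast
    then have "orthogonal_transformation (S \<circ> R)" "(S \<circ> R) x \<in> int_lattice"
      using R(1) orthogonal_transformation_compose by auto
    then show ?case by blast
  qed
  then obtain R :: "real ^ 'n \<Rightarrow> real ^ 'n" where R: "orthogonal_transformation R" "R x \<in> int_lattice" by blast
  have "orthogonal_transformation (inv R)" using R(1) by (rule orthogonal_transformation_inv)
  moreover have "x = inv R (R x)" using orthogonal_transformation_inj[OF R(1)] by simp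
  ultimately show ?thesis using that R(2) by blast
qed

section \<open>Theta functions\<close>

text \<open>\<open>theta3\<close> and \<open>theta4\<close> are Jacobi's theta constants at nome
  \<open>exp (- t)\<close>.\<close>

definition theta3 :: "real \<Rightarrow> real" where
  "theta3 t = (\<Sum>\<^sub>\<infinity>k::int. exp (- t * (real_of_int k)\<^sup>2))"

definition parity_sign :: "int \<Rightarrow> real" where
  "parity_sign k = (if even k then 1 else - 1)"

definition theta4 :: "real \<Rightarrow> real" where
  "theta4 t = (\<Sum>\<^sub>\<infinity>k::int. parity_sign k * exp (- t * (real_of_int k)\<^sup>2))"

lemma summable_theta3: "t > 0 \<Longrightarrow> (\<lambda>k::int. exp (- t * (real_of_int k)\<^sup>2)) summable_on UNIV"
  using summable_gaussian_int[of t "\<lambda>_. 1"] by simp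

lemma summable_theta4: "t > 0 \<Longrightarrow> (\<lambda>k::int. parity_sign k * exp (- t * (real_of_int k)\<^sup>2)) summable_on UNIV"
  by (rule summable_gaussian_int) (auto simp: parity_sign_def)

text \<open>In \<open>theta3 t + theta4 t\<close> the odd terms cancel and the even ones double; in
  the difference the roles are exchanged. Both series have nonnegative terms, and the index
  \<open>0\<close>, respectively \<open>1\<close>, gives a positive one.\<close>

lemma abs_theta4_less_theta3:
  assumes "t > 0"
  shows "\<bar>theta4 t\<bar> < theta3 t"
proof -
  let ?e = "\<lambda>k::int. exp (- t * (real_of_int k)\<^sup>2)"
  have pos: "0 < infsum (\<lambda>k. ?e k + c * (parity_sign k * ?e k)) UNIV"
    if "\<And>k. 1 + c * parity_sign k \<ge> 0" "1 + c * parity_sign k0 > 0" for c k0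
  proof -
    have e: "?e k + c * (parity_sign k * ?e k) = (1 + c * parity_sign k) * ?e k" for k
      by (simp add: algebra_simps)
    have "(\<lambda>k. ?e k + c * (parity_sign k * ?e k)) summable_on UNIV"
      by (intro summable_on_add summable_on_cmult_right summable_theta3 summable_theta4 assms)
    then have "sum (\<lambda>k. ?e k + c * (parity_sign k * ?e k)) {k0} \<le> infsum (\<lambda>k. ?e k + c * (parity_sign k * ?e k)) UNIV"
      by (rule finite_sum_le_infsum) (use that(1) in \<open>auto simp only: e intro!: mult_nonneg_nonneg\<close>, auto)
    moreover have "sum (\<lambda>k. ?e k + c * (parity_sign k * ?e k)) {k0} > 0"
      using that(2) by (simp only: e sum.empty sum.insert finite.emptyI empty_iff not_False_eq_True) simp
    ultimately show ?thesis by linarith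
  qed
  have eq: "infsum (\<lambda>k. ?e k + c * (parity_sign k * ?e k)) UNIV = theta3 t + c * theta4 t" for c
    unfolding theta3_def theta4_def
    by (subst infsum_add, rule summable_theta3[OF assms],
      rule summable_on_cmult_right[OF summable_theta4[OF assms]], simp only: infsum_cmult_right')
  have "0 < theta3 t + 1 * theta4 t"
    unfolding eq[symmetric] by (rule pos[of 1 0]) (auto simp: parity_sign_def)
  moreover have "0 < theta3 t + (- 1) * theta4 t"
    unfolding eq[symmetric] by (rule pos[of "- 1" 1]) (auto simp: parity_sign_def)
  ultimately show ?thesis by linarith
qed

lemma infsum_mult_product:
  fixes f :: "'a \<Rightarrow> real" and g :: "'b \<Rightarrow> real"
  assumes f: "f summable_on A" and g: "g summable_on B"
  shows "(\<lambda>(a, b). f a * g b) summable_on A \<times> B"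
    and "(\<Sum>\<^sub>\<infinity>(a, b)\<in>A \<times> B. f a * g b) = infsum f A * infsum g B"
proof -
  have f': "(\<lambda>a. norm (f a)) summable_on A" and g': "(\<lambda>b. norm (g b)) summable_on B"
    using f g by (simp_all only: summable_on_iff_abs_summable_on_real[symmetric])
  have "(\<lambda>p. norm (case p of (a, b) \<Rightarrow> f a * g b)) summable_on A \<times> B"
    unfolding Infinite_Sum.abs_summable_on_Sigma_iff
    using f' g' by (auto simp: abs_mult infsum_cmult_right' intro!: summable_on_cmult_right summable_on_cmult_left)
  then show s: "(\<lambda>(a, b). f a * g b) summable_on A \<times> B"
    by (rule iffD2[OF summable_on_iff_abs_summable_on_real])
  have "(\<Sum>\<^sub>\<infinity>(a, b)\<in>A \<times> B. f a * g b) = (\<Sum>\<^sub>\<infinity>a\<in>A. \<Sum>\<^sub>\<infinity>b\<in>B. f a * g b)"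
    using infsum_Sigma'_banach[OF s] by simp
  also have "\<dots> = infsum f A * infsum g B"
    by (simp add: infsum_cmult_right' infsum_cmult_left')
  finally show "(\<Sum>\<^sub>\<infinity>(a, b)\<in>A \<times> B. f a * g b) = infsum f A * infsum g B" .
qed

text \<open>
  In the double series for the right-hand side, the pairs of different parity cancel under the swap;
  the others are parametrized by \<open>(m + n, m - n)\<close>.
\<close>

lemma theta4_double:
  assumes t: "t > 0"
  shows "theta4 (2 * t) ^ 2 = theta3 t * theta4 t"
proof -
  let ?e = "\<lambda>t (k::int). exp (- t * (real_of_int k)\<^sup>2)"
  define F where "F = (\<lambda>(a, b). ?e t a * (parity_sign b * ?e t b))"
  have F: "F summable_on UNIV" "infsum F UNIV = theta3 t * theta4 t"
    using infsum_mult_product[OF summable_theta3[OF t] summable_theta4[OF t]]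
    by (simp_all add: F_def theta3_def theta4_def)
  define E where "E = {p :: int \<times> int. even (fst p + snd p)}"
  have "infsum F UNIV = infsum F E + infsum F (- E)"
    using infsum_Un_disjoint[of F E "- E"] summable_on_subset_banach[OF F(1)] by simp
  also have "infsum F (- E) = 0"
  proof -
    have "infsum F (- E) = infsum (\<lambda>p. - F p) (- E)"
      by (rule infsum_reindex_bij_witness[where i = prod.swap and j = prod.swap])
        (auto simp: E_def F_def parity_sign_def)
    then show ?thesis by (simp add: infsum_uminus)
  qed
  also have "infsum F E = (\<Sum>\<^sub>\<infinity>(m, n). (parity_sign m * ?e (2 * t) m) * (parity_sign n * ?e (2 * t) n))"
  proof (rule infsum_reindex_bij_witness[where i = "\<lambda>(m, n). (m + n, m - n)" and j = "\<lambda>(a, b). ((a + b) div 2, (a - b) div 2)"])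
    fix p assume "p \<in> E"
    obtain a b where ab: "p = (a, b)" by (cases p)
    with \<open>p \<in> E\<close> have "even (a + b)" by (simp add: E_def)
    then obtain m where "a + b = 2 * m" by (rule evenE)
    then have b: "b = 2 * m - a" by simp
    show "(case case p of (a, b) \<Rightarrow> ((a + b) div 2, (a - b) div 2) of (m, n) \<Rightarrow> (m + n, m - n)) = p"
      unfolding ab b by simp
    show "(case case p of (a, b) \<Rightarrow> ((a + b) div 2, (a - b) div 2) of
        (m, n) \<Rightarrow> parity_sign m * ?e (2 * t) m * (parity_sign n * ?e (2 * t) n)) = F p"
    proof -
      have d: "(a + b) div 2 = m" "(a - b) div 2 = a - m" unfolding b by auto
      \<comment> \<open>With \<open>n = a - m\<close> this is the identity \<open>(m + n)\<^sup>2 +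
        (m - n)\<^sup>2 = 2 * (m\<^sup>2 + n\<^sup>2)\<close>, the source of the doubled
        argument.\<close>
      have "?e (2 * t) m * ?e (2 * t) (a - m) = ?e t a * ?e t b"
        unfolding b by (simp add: exp_add[symmetric] power2_eq_square algebra_simps)
      moreover have "parity_sign m * parity_sign (a - m) = parity_sign b"
        unfolding b by (auto simp: parity_sign_def)
      ultimately show ?thesis
        by (simp add: ab d F_def mult_ac)
    qed
  qed (auto simp: E_def)
  also have "\<dots> = theta4 (2 * t) * theta4 (2 * t)"
    using infsum_mult_product(2)[OF summable_theta4 summable_theta4, of "2 * t" "2 * t"] t
    by (simp add: theta4_def)
  finally show ?thesis by (simp add: F(2) power2_eq_square)
qed

text \<open>For \<open>k \<noteq> 0\<close> one has \<open>k\<^sup>2 \<ge> 1\<close>, so raising the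
  parameter from \<open>t\<close> to \<open>T\<close> gains at least the factor
  \<open>exp (t - T)\<close> in every term but the central one, which is \<open>1\<close>.\<close>

lemma theta4_near_1:
  assumes t: "t > 0" and T: "T \<ge> t"
  shows "\<bar>theta4 T - 1\<bar> \<le> exp (t - T) * theta3 t"
proof -
  let ?e = "\<lambda>t (k::int). exp (- t * (real_of_int k)\<^sup>2)"
  have T0: "T > 0" using t T by simp
  have U: "UNIV = insert 0 (UNIV - {0 :: int})" by auto
  have s: "(\<lambda>k. parity_sign k * ?e T k) summable_on UNIV - {0}"
    using summable_on_subset_banach[OF summable_theta4[OF T0]] by blast
  have s': "(\<lambda>k. norm (parity_sign k * ?e T k)) summable_on UNIV - {0}"
    by (rule iffD1[OF summable_on_iff_abs_summable_on_real s])
  have s3: "(\<lambda>k. exp (t - T) * ?e t k) summable_on UNIV - {0}"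
    using summable_on_subset_banach[OF summable_theta3[OF t]] by (intro summable_on_cmult_right) blast
  have "theta4 T = 1 + (\<Sum>\<^sub>\<infinity>k\<in>UNIV - {0}. parity_sign k * ?e T k)"
    unfolding theta4_def by (subst U, subst infsum_insert[OF s]) (auto simp: parity_sign_def)
  then have "\<bar>theta4 T - 1\<bar> = norm (\<Sum>\<^sub>\<infinity>k\<in>UNIV - {0}. parity_sign k * ?e T k)"
    by simp
  also have "\<dots> \<le> (\<Sum>\<^sub>\<infinity>k\<in>UNIV - {0}. norm (parity_sign k * ?e T k))"
    by (rule norm_infsum_bound[OF s'])
  also have "\<dots> \<le> (\<Sum>\<^sub>\<infinity>k\<in>UNIV - {0}. exp (t - T) * ?e t k)"
  proof (rule infsum_mono[OF s' s3])
    fix k :: int assume "k \<in> UNIV - {0}"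
    then have "1 \<le> k\<^sup>2" by (simp add: int_one_le_iff_zero_less)
    then have "1 \<le> (real_of_int k)\<^sup>2" by (metis of_int_1_le_iff of_int_power)
    then have "(T - t) * 1 \<le> (T - t) * (real_of_int k)\<^sup>2" using T by (intro mult_left_mono) auto
    then have "- T * (real_of_int k)\<^sup>2 \<le> (t - T) + - t * (real_of_int k)\<^sup>2" by (simp add: algebra_simps)
    then have "?e T k \<le> exp (t - T) * ?e t k" by (simp only: exp_add[symmetric] exp_le_cancel_iff)
    then show "norm (parity_sign k * ?e T k) \<le> exp (t - T) * ?e t k" by (simp add: parity_sign_def)
  qed
  also have "\<dots> = exp (t - T) * (\<Sum>\<^sub>\<infinity>k\<in>UNIV - {0}. ?e t k)"
    by (rule infsum_cmult_right')
  also have "\<dots> \<le> exp (t - T) * theta3 t"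
    unfolding theta3_def
    using summable_theta3[OF t] summable_on_subset_banach[OF summable_theta3[OF t]]
    by (intro mult_left_mono infsum_mono2) auto
  finally show ?thesis .
qed

text \<open>A zero at \<open>t\<close> would propagate to \<open>2 ^ k * t\<close>, but \<open>theta4\<close> tends to \<open>1\<close>.\<close>

lemma theta4_nonzero:
  assumes t: "t > 0"
  shows "theta4 t \<noteq> 0"
proof
  assume z: "theta4 t = 0"
  have zk: "theta4 (2 ^ k * t) = 0" for k
  proof (induction k)
    case (Suc k)
    then show ?case using theta4_double[of "2 ^ k * t"] t by (simp add: mult.assoc)
  qed (simp add: z)
  \<comment> \<open>By \<open>2 ^ k \<ge> k + 1\<close> this choice makes
    \<open>exp (2 ^ k * t - t)\<close> larger than \<open>theta3 t\<close>, whereas a zero at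
    \<open>2 ^ k * t\<close> would force the opposite inequality.\<close>
  obtain k :: nat where k: "theta3 t < real k * t"
    using reals_Archimedean3[OF t] by blast
  have "real k + 1 \<le> 2 ^ k" using of_nat_mono[OF Suc_leI[OF less_exp[of k]], where 'a = real] by simp
  then have "(real k + 1) * t \<le> 2 ^ k * t" using t by (intro mult_right_mono) auto
  then have kt: "real k * t \<le> 2 ^ k * t - t" by (simp add: algebra_simps)
  have kt0: "0 \<le> real k * t" using t by simp
  have "1 \<le> exp (t - 2 ^ k * t) * theta3 t"
    using theta4_near_1[OF t, of "2 ^ k * t"] zk[of k] kt kt0 by simp
  then have "exp (2 ^ k * t - t) * 1 \<le> exp (2 ^ k * t - t) * (exp (t - 2 ^ k * t) * theta3 t)"
    by (intro mult_left_mono) auto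
  also have "\<dots> = theta3 t" by (simp add: mult.assoc[symmetric] exp_add[symmetric])
  finally have "exp (2 ^ k * t - t) \<le> theta3 t" by simp
  moreover have "1 + (2 ^ k * t - t) \<le> exp (2 ^ k * t - t)" by (rule exp_ge_add_one_self)
  ultimately show False using k kt by linarith
qed

section \<open>The equality case\<close>

lemma norm_sq_int_lattice:
  fixes x :: "real ^ 'n"
  assumes "x \<in> int_lattice"
  shows "(norm x)\<^sup>2 = (\<Sum>i\<in>UNIV. (real_of_int \<lfloor>x $ i\<rfloor>)\<^sup>2)"
  using assms by (simp add: norm_eq_sqrt_inner inner_vec_def power2_eq_square int_lattice_def sum_nonneg)

text \<open>The Gaussian factors over the coordinates. A separate weight for each coordinate allows
  mixed products with some factors \<open>theta4\<close> and the others
  \<open>theta3\<close>.\<close>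

lemma gaussian_lattice_sum:
  fixes c :: "'n::finite \<Rightarrow> int \<Rightarrow> real"
  assumes t: "t > 0" and c: "\<And>i k. \<bar>c i k\<bar> \<le> 1"
  shows "(\<lambda>x :: real ^ 'n. (\<Prod>i\<in>UNIV. c i \<lfloor>x $ i\<rfloor>) * exp (- t * (norm x)\<^sup>2)) summable_on int_lattice"
    and "(\<Sum>\<^sub>\<infinity>x\<in>(int_lattice :: (real ^ 'n) set). (\<Prod>i\<in>UNIV. c i \<lfloor>x $ i\<rfloor>) * exp (- t * (norm x)\<^sup>2)) =
      (\<Prod>i\<in>UNIV. \<Sum>\<^sub>\<infinity>k. c i k * exp (- t * (real_of_int k)\<^sup>2))"
proof -
  define f where "f = (\<lambda>i k. c i k * exp (- t * (real_of_int k)\<^sup>2))"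
  have eq: "(\<Prod>i\<in>UNIV. c i \<lfloor>x $ i\<rfloor>) * exp (- t * (norm x)\<^sup>2) = (\<Prod>i\<in>UNIV. f i \<lfloor>x $ i\<rfloor>)"
    if "x \<in> int_lattice" for x :: "real ^ 'n"
    unfolding f_def prod.distrib norm_sq_int_lattice[OF that] sum_distrib_left by (simp add: exp_sum)
  have f: "f i summable_on UNIV" for i
    unfolding f_def by (rule summable_gaussian_int[OF t c])
  have "(\<lambda>x :: real ^ 'n. \<Prod>i\<in>UNIV. f i \<lfloor>x $ i\<rfloor>) summable_on int_lattice"
    by (rule iffD2[OF summable_on_iff_abs_summable_on_real infsum_int_lattice_prod(1)[OF f]])
  then show "(\<lambda>x :: real ^ 'n. (\<Prod>i\<in>UNIV. c i \<lfloor>x $ i\<rfloor>) * exp (- t * (norm x)\<^sup>2)) summable_on int_lattice"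
    by (rule iffD2[OF summable_on_cong, rotated]) (rule eq)
  have "(\<Sum>\<^sub>\<infinity>x\<in>(int_lattice :: (real ^ 'n) set). (\<Prod>i\<in>UNIV. c i \<lfloor>x $ i\<rfloor>) * exp (- t * (norm x)\<^sup>2)) =
      (\<Sum>\<^sub>\<infinity>x\<in>(int_lattice :: (real ^ 'n) set). \<Prod>i\<in>UNIV. f i \<lfloor>x $ i\<rfloor>)"
    by (rule infsum_cong[OF eq])
  also have "\<dots> = (\<Prod>i\<in>UNIV. \<Sum>\<^sub>\<infinity>k. f i k)"
    by (rule infsum_int_lattice_prod(2)[OF f])
  finally show "(\<Sum>\<^sub>\<infinity>x\<in>(int_lattice :: (real ^ 'n) set). (\<Prod>i\<in>UNIV. c i \<lfloor>x $ i\<rfloor>) * exp (- t * (norm x)\<^sup>2)) =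
      (\<Prod>i\<in>UNIV. \<Sum>\<^sub>\<infinity>k. c i k * exp (- t * (real_of_int k)\<^sup>2))"
    by (simp only: f_def)
qed

section \<open>The parity character and half-integral frequencies\<close>

lemma cos_pi_int: "cos (pi * of_int k) = parity_sign k"
proof (cases "even k")
  case True
  then obtain m where "k = 2 * m" by (rule evenE)
  then show ?thesis using cos_int_2pin[of m] by (simp add: parity_sign_def mult_ac)
next
  case False
  then obtain m where m: "k = 2 * m + 1" by (rule oddE)
  then have "pi * of_int k = 2 * pi * of_int m + pi" by (simp add: algebra_simps)
  then show ?thesis using m by (simp add: parity_sign_def cos_add)
qed

lemma parity_sign_sum: "finite U \<Longrightarrow> parity_sign (\<Sum>i\<in>U. k i) = (\<Prod>i\<in>U. parity_sign (k i))"
  by (induction U rule: finite_induct) (auto simp: parity_sign_def)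

text \<open>The sign character attached to \<open>U\<close>, encoded as a frequency: multiplying
  \<open>h\<close> by the corresponding cosine shifts its transform by this vector in both
  directions.\<close>

definition half_vector :: "'n set \<Rightarrow> real ^ 'n" where
  "half_vector U = (\<chi> i. if i \<in> U then 1/2 else 0)"

lemma cos_half_vector:
  fixes m :: "real ^ 'n"
  assumes "m \<in> int_lattice"
  shows "cos (2 * pi * (half_vector U \<bullet> m)) = (\<Prod>i\<in>UNIV. if i \<in> U then parity_sign \<lfloor>m $ i\<rfloor> else 1)"
proof -
  have "half_vector U \<bullet> m = (\<Sum>i\<in>UNIV. if i \<in> U then m $ i / 2 else 0)"
    unfolding half_vector_def inner_vec_def by (rule sum.cong) auto
  also have "\<dots> = (\<Sum>i\<in>U. m $ i / 2)"
    by (simp add: sum.If_cases)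
  also have "\<dots> = of_int (\<Sum>i\<in>U. \<lfloor>m $ i\<rfloor>) / 2"
    using assms by (simp add: int_lattice_def sum_divide_distrib)
  finally have "cos (2 * pi * (half_vector U \<bullet> m)) = cos (pi * of_int (\<Sum>i\<in>U. \<lfloor>m $ i\<rfloor>))"
    by (simp only:) simp
  also have "\<dots> = (\<Prod>i\<in>U. parity_sign \<lfloor>m $ i\<rfloor>)"
    unfolding cos_pi_int by (rule parity_sign_sum) simp
  also have "\<dots> = (\<Prod>i\<in>UNIV. if i \<in> U then parity_sign \<lfloor>m $ i\<rfloor> else 1)"
    by (simp add: prod.If_cases)
  finally show ?thesis .
qed

lemma half_integral_half_vector:
  assumes "k \<in> int_lattice"
  shows "half_integral_on U (half_vector U + k)" "half_integral_on U (half_vector U - k)"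
  using assms by (auto simp: half_integral_on_def half_vector_def int_lattice_def)

text \<open>Keeps the shifted frequencies away from \<open>0\<close>, where the equality case gives
  no information.\<close>

lemma half_integral_nonzero:
  assumes "half_integral_on U x" "U \<noteq> {}"
  shows "x \<noteq> 0"
proof
  assume x: "x = 0"
  obtain i where "i \<in> U" using assms(2) by blast
  then have "x $ i - 1/2 \<in> \<int>" using assms(1) unfolding half_integral_on_def by metis
  then obtain k where "- (1/2) = real_of_int k" using x by (auto elim: Ints_cases)
  then have "real_of_int (2 * k + 1) = 0" by simp
  then have "2 * k + 1 = 0" by (simp only: of_int_eq_0_iff)
  then show False by presburger
qed

lemma has_sum_delta:
  assumes "a \<in> A"
  shows "((\<lambda>x. if x = a then c else 0) has_sum c) A"
proof -
  have "((\<lambda>x. if x = a then c else 0) has_sum c) {a}"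
    using has_sum_finite[of "{a}" "\<lambda>x. if x = a then c else 0"] by simp
  moreover have "((\<lambda>x. if x = a then c else 0) has_sum c) {a} \<longleftrightarrow> ((\<lambda>x. if x = a then c else 0) has_sum c) A"
    by (rule has_sum_cong_neutral) (use assms in auto)
  ultimately show ?thesis by simp
qed

text \<open>The total slack \<open>infsum D\<close> is a sum of nonnegative terms and, by the
  Poisson bound and \<open>le\<close>, at most \<open>2 * real_fourier h (R k)\<close>, which is
  nonpositive. So the slack at \<open>k\<close> and the transform at \<open>R k\<close> both
  vanish.\<close>

lemma equality_case:
  fixes h :: "real ^ 'n \<Rightarrow> real" and R :: "real ^ 'n \<Rightarrow> real ^ 'n"
  assumes t: "t > 0" and h: "schwartz h"
    and lower: "\<And>L x. unimodular_lattice L \<Longrightarrow> integral_lattice L \<Longrightarrow> x \<in> L \<Longrightarrow> x \<noteq> 0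
           \<Longrightarrow> h x \<ge> exp (- t * (norm x)\<^sup>2)"
    and upper: "\<And>L x. unimodular_lattice L \<Longrightarrow> integral_lattice L \<Longrightarrow> x \<in> L \<Longrightarrow> x \<noteq> 0
           \<Longrightarrow> real_fourier h x \<le> 0"
    and le: "1 + real_fourier h 0 - h 0 \<le> gaussian_mass (int_lattice :: (real ^ 'n) set) t"
    and R: "orthogonal_transformation R" and k: "k \<in> int_lattice" "k \<noteq> 0"
  shows "h (R k) = exp (- t * (norm (R k))\<^sup>2)" "real_fourier h (R k) = 0"
proof -
  let ?L = "int_lattice :: (real ^ 'n) set"
  let ?e = "\<lambda>x :: real ^ 'n. exp (- t * (norm x)\<^sup>2)"
  have dR: "decays (\<lambda>x. h (R x))" by (rule decays_schwartz_orthogonal[OF h R])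
  have dh: "decays h" using decays_schwartz_orthogonal[OF h orthogonal_transformation_id] by simp
  have R0: "R 0 = 0" using orthogonal_transformation_linear[OF R] by (rule linear_0)
  have Rnz: "R j \<noteq> 0" if "j \<noteq> 0" for j
    using orthogonal_transformation_norm[OF R, of j] that by auto
  have tr: "cos_transform (\<lambda>x. h (R x)) j = real_fourier h (R j)" for j
    by (simp add: cos_transform_orthogonal[OF dh R] real_fourier_eq_cos_transform[OF dh])
  note lat = unimodular_integral_orthogonal_image[OF R]
  have neg: "real_fourier h (R j) \<le> 0" if "j \<in> ?L" "j \<noteq> 0" for j
    using upper[OF lat imageI[OF that(1)] Rnz[OF that(2)]] .
  \<comment> \<open>The correction at the origin makes \<open>D 0 = 0\<close>, since
    \<open>h 0\<close> is not bounded below by assumption. The Gaussian is taken at \<open>m\<close>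
    because \<open>R\<close> preserves norms.\<close>
  define D where "D = (\<lambda>m. h (R m) - ?e m - (if m = 0 then h 0 - 1 else 0))"
  have D0: "D m \<ge> 0" if "m \<in> ?L" for m
    using lower[OF lat imageI[OF that] Rnz[of m]] orthogonal_transformation_norm[OF R, of m]
    by (auto simp: D_def R0)
  have se: "?e summable_on ?L"
    using gaussian_lattice_sum(1)[OF t, of "\<lambda>_ _. 1"] by simp
  have sh: "(\<lambda>m. h (R m)) summable_on ?L" by (rule decays_summable[OF dR])
  have s0: "((\<lambda>m. if m = 0 then h 0 - 1 else 0) has_sum (h 0 - 1)) ?L"
    by (rule has_sum_delta) simp
  have se': "((\<lambda>m. - ?e m) has_sum - infsum ?e ?L) ?L"
    and s0': "((\<lambda>m. - (if m = 0 then h 0 - 1 else 0)) has_sum - (h 0 - 1)) ?L"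
    using has_sum_infsum[OF se] s0 by (simp_all only: has_sum_uminus minus_minus)
  have "((\<lambda>m. h (R m) + - ?e m + - (if m = 0 then h 0 - 1 else 0)) has_sum
      (infsum (\<lambda>m. h (R m)) ?L + - infsum ?e ?L + - (h 0 - 1))) ?L"
    by (rule has_sum_add[OF has_sum_add[OF has_sum_infsum[OF sh] se'] s0'])
  then have hs: "(D has_sum (infsum (\<lambda>m. h (R m)) ?L - gaussian_mass ?L t - (h 0 - 1))) ?L"
    by (simp only: D_def gaussian_mass_def diff_conv_add_uminus)
  have "infsum (\<lambda>m. h (R m)) ?L \<le> real_fourier h 0 + 2 * real_fourier h (R k)"
    using poisson_upper_bound[OF dR _ k] neg by (simp add: tr R0)
  then have S: "infsum D ?L \<le> 2 * real_fourier h (R k)"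
    using le infsumI[OF hs] by linarith
  have Dk: "D k \<le> infsum D ?L"
    using finite_sum_le_infsum[OF has_sum_imp_summable[OF hs], of "{k}"] k D0 by auto
  show "real_fourier h (R k) = 0"
    using S Dk D0[OF k(1)] neg[OF k] by linarith
  have "D k = 0"
    using S Dk D0[OF k(1)] neg[OF k] by linarith
  then show "h (R k) = exp (- t * (norm (R k))\<^sup>2)"
    using k(2) orthogonal_transformation_norm[OF R, of k] by (simp add: D_def)
qed

text \<open>The cosine transform of the twisted function at a lattice frequency \<open>k\<close> is
  the mean of the transforms of \<open>h\<close> at \<open>half_vector U - k\<close> and
  \<open>half_vector U + k\<close>, both zero. The twisted lattice sum thus vanishes, and it can be
  computed because \<open>h\<close> is Gaussian off the origin.\<close>

lemma twisted_sum:
  fixes h :: "real ^ 'n \<Rightarrow> real"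
  assumes t: "t > 0" and h: "decays h"
    and val: "\<And>m. m \<in> int_lattice \<Longrightarrow> m \<noteq> 0 \<Longrightarrow> h m = exp (- t * (norm m)\<^sup>2)"
    and zero: "\<And>x. half_integral_on U x \<Longrightarrow> cos_transform h x = 0"
  shows "theta4 t ^ card U * theta3 t ^ (CARD('n) - card U) = 1 - h 0"
proof -
  let ?L = "int_lattice :: (real ^ 'n) set"
  let ?e = "\<lambda>x :: real ^ 'n. exp (- t * (norm x)\<^sup>2)"
  define c where "c = (\<lambda>(i :: 'n) k. if i \<in> U then parity_sign k else 1)"
  define g where "g = (\<lambda>x. h x * cos (2 * pi * (half_vector U \<bullet> x)))"
  have g: "decays g"
    unfolding g_def by (rule decays_mult_bounded[OF h, of _ 1]) (auto intro!: continuous_intros)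
  have "cos_transform g k = 0" if k: "k \<in> ?L" for k
  proof -
    have int: "integrable lborel (\<lambda>x. h x * cos (2 * pi * (v \<bullet> x)))" for v
      by (rule decays_integrable[OF decays_mult_bounded[OF h, of _ 1]]) (auto intro!: continuous_intros)
    have split: "a * b * c = (1/2) * (a * p + a * q)" if "b * c = (1/2) * (p + q)" for a b c p q :: real
      using that by (simp add: mult.assoc distrib_left)
    have "cos_transform g k = (LINT x|lborel. (1/2) * (h x * cos (2 * pi * ((half_vector U - k) \<bullet> x))
        + h x * cos (2 * pi * ((half_vector U + k) \<bullet> x))))"
      unfolding cos_transform_def g_def
    proof (rule Bochner_Integration.integral_cong[OF refl])
      show "h x * cos (2 * pi * (half_vector U \<bullet> x)) * cos (2 * pi * (k \<bullet> x)) =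
          (1/2) * (h x * cos (2 * pi * ((half_vector U - k) \<bullet> x)) + h x * cos (2 * pi * ((half_vector U + k) \<bullet> x)))" for x
        by (rule split[OF cos_mult_cos_inner])
    qed
    also have "\<dots> = (1/2) * (cos_transform h (half_vector U - k) + cos_transform h (half_vector U + k))"
      using int by (simp add: cos_transform_def)
    also have "\<dots> = 0"
      using half_integral_half_vector[OF k] zero by simp
    finally show ?thesis .
  qed
  \<comment> \<open>Frequency \<open>0\<close> is included: the twist moves it to
    \<open>half_vector U\<close>, so no main term survives.\<close>
  then have "infsum g ?L = 0"
    using poisson_vanishing[OF g] by simp
  have sc: "(\<lambda>m. (\<Prod>i\<in>UNIV. c i \<lfloor>m $ i\<rfloor>) * ?e m) summable_on ?L"
    and vc: "infsum (\<lambda>m. (\<Prod>i\<in>UNIV. c i \<lfloor>m $ i\<rfloor>) * ?e m) ?L = (\<Prod>i\<in>UNIV. \<Sum>\<^sub>\<infinity>k. c i k * exp (- t * (real_of_int k)\<^sup>2))"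
    by (rule gaussian_lattice_sum[OF t]; simp add: c_def parity_sign_def)+
  have "(\<Prod>i\<in>UNIV. \<Sum>\<^sub>\<infinity>k. c i k * exp (- t * (real_of_int k)\<^sup>2)) = (\<Prod>i\<in>UNIV. if i \<in> U then theta4 t else theta3 t)"
    by (rule prod.cong) (auto simp: c_def theta3_def theta4_def)
  also have "\<dots> = theta4 t ^ card U * theta3 t ^ (CARD('n) - card U)"
    by (simp add: prod.If_cases Compl_eq_Diff_UNIV card_Diff_subset)
  finally have v: "infsum (\<lambda>m. (\<Prod>i\<in>UNIV. c i \<lfloor>m $ i\<rfloor>) * ?e m) ?L = theta4 t ^ card U * theta3 t ^ (CARD('n) - card U)"
    using vc by simp
  have s0: "((\<lambda>m. if m = 0 then h 0 - 1 else 0) has_sum (h 0 - 1)) ?L"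
    by (rule has_sum_delta) simp
  have "((\<lambda>m. (\<Prod>i\<in>UNIV. c i \<lfloor>m $ i\<rfloor>) * ?e m + (if m = 0 then h 0 - 1 else 0)) has_sum
      (theta4 t ^ card U * theta3 t ^ (CARD('n) - card U) + (h 0 - 1))) ?L"
    unfolding v[symmetric] by (intro has_sum_add has_sum_infsum sc s0)
  \<comment> \<open>At the origin the twist is \<open>1\<close>, so replacing \<open>h\<close> by
    the Gaussian there costs exactly \<open>h 0 - 1\<close>.\<close>
  moreover have "(\<Prod>i\<in>UNIV. c i \<lfloor>m $ i\<rfloor>) * ?e m + (if m = 0 then h 0 - 1 else 0) = g m" if "m \<in> ?L" for m
  proof (cases "m = 0")
    case True
    then show ?thesis by (simp add: g_def c_def parity_sign_def cong: if_cong)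
  next
    case False
    then show ?thesis
      unfolding g_def cos_half_vector[OF that] val[OF that False] c_def by (simp only: if_False add_0_right mult.commute)
  qed
  ultimately have "(g has_sum (theta4 t ^ card U * theta3 t ^ (CARD('n) - card U) + (h 0 - 1))) ?L"
    by (rule iffD1[OF has_sum_cong, rotated])
  then have "infsum g ?L = theta4 t ^ card U * theta3 t ^ (CARD('n) - card U) + (h 0 - 1)"
    by (rule infsumI)
  then show ?thesis
    using \<open>infsum g ?L = 0\<close> by linarith
qed

theorem corollary1p2:
  fixes h :: "real ^ 'n \<Rightarrow> real" and t :: real
  assumes "CARD('n) \<ge> 8"
    and "t > 0"
    and "schwartz h"
    and "\<And>x. h (- x) = h x"
    and "\<And>L x. unimodular_lattice L \<Longrightarrow> integral_lattice L \<Longrightarrow> x \<in> L \<Longrightarrow> x \<noteq> 0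
           \<Longrightarrow> h x \<ge> exp (- t * (norm x)\<^sup>2)"
    and "\<And>L x. unimodular_lattice L \<Longrightarrow> integral_lattice L \<Longrightarrow> x \<in> L \<Longrightarrow> x \<noteq> 0
           \<Longrightarrow> real_fourier h x \<le> 0"
  shows "1 + real_fourier h 0 - h 0 > gaussian_mass (int_lattice :: (real ^ 'n) set) t"
proof (rule ccontr)
  assume "\<not> 1 + real_fourier h 0 - h 0 > gaussian_mass (int_lattice :: (real ^ 'n) set) t"
  then have le: "1 + real_fourier h 0 - h 0 \<le> gaussian_mass (int_lattice :: (real ^ 'n) set) t"
    by simp
  have eq: "h (R k) = exp (- t * (norm (R k))\<^sup>2)" "real_fourier h (R k) = 0"
    if "orthogonal_transformation R" "k \<in> int_lattice" "k \<noteq> 0" for R :: "real ^ 'n \<Rightarrow> real ^ 'n" and k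
    by (rule equality_case[OF assms(2,3) _ _ le that]; (rule assms(5,6); assumption))+
  have dh: "decays h" using decays_schwartz_orthogonal[OF assms(3) orthogonal_transformation_id] by simp
  have val: "h m = exp (- t * (norm m)\<^sup>2)" if "m \<in> int_lattice" "m \<noteq> 0" for m
    using eq(1)[OF orthogonal_transformation_id that] .
  have tw: "theta4 t ^ (4 * j) * theta3 t ^ (CARD('n) - 4 * j) = 1 - h 0"
    if j: "j > 0" and jn: "4 * j \<le> CARD('n)" for j
  proof -
    obtain U :: "'n set" where U: "card U = 4 * j"
      using obtain_subset_with_card_n[OF jn] by metis
    have "U \<noteq> {}" using U j by auto
    have "cos_transform h x = 0" if x: "half_integral_on U x" for x
    proof -
      obtain R :: "real ^ 'n \<Rightarrow> real ^ 'n" and z where R: "orthogonal_transformation R" "z \<in> int_lattice" "x = R z"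
        using half_integral_rotates_to_lattice[OF U x] by blast
      have "x \<noteq> 0" using half_integral_nonzero[OF x \<open>U \<noteq> {}\<close>] .
      then have "z \<noteq> 0" using R linear_0[OF orthogonal_transformation_linear[OF R(1)]] by auto
      then show ?thesis
        using eq(2)[OF R(1,2)] R(3) real_fourier_eq_cos_transform[OF dh] by simp
    qed
    then show ?thesis
      using twisted_sum[OF assms(2) dh val, of U] U by simp
  qed
  have lt: "\<bar>theta4 t\<bar> < theta3 t" by (rule abs_theta4_less_theta3[OF assms(2)])
  \<comment> \<open>Exact for natural-number subtraction because \<open>CARD('n) \<ge> 8\<close>; it
    exposes the factor common to the identities for \<open>j = 1\<close> and
    \<open>j = 2\<close>.\<close>
  have "CARD('n) - 4 = 4 + (CARD('n) - 8)" using assms(1) by simp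
  then have "theta3 t ^ (CARD('n) - 4) = theta3 t ^ 4 * theta3 t ^ (CARD('n) - 8)"
    by (simp only: power_add)
  moreover have "theta4 t ^ 8 = theta4 t ^ 4 * theta4 t ^ 4"
    by (simp flip: power_add)
  moreover have "theta4 t ^ 4 * theta3 t ^ (CARD('n) - 4) = theta4 t ^ 8 * theta3 t ^ (CARD('n) - 8)"
    using tw[of 1] tw[of 2] assms(1) by simp
  ultimately have "theta4 t ^ 4 * theta3 t ^ (CARD('n) - 8) * theta3 t ^ 4
      = theta4 t ^ 4 * theta3 t ^ (CARD('n) - 8) * theta4 t ^ 4"
    by (simp only: ac_simps)
  moreover have "theta4 t ^ 4 * theta3 t ^ (CARD('n) - 8) \<noteq> 0"
    using theta4_nonzero[OF assms(2)] lt by auto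
  ultimately have "theta3 t ^ 4 = theta4 t ^ 4"
    using mult_left_cancel by blast
  then have "theta3 t ^ 4 = \<bar>theta4 t\<bar> ^ 4" by simp
  moreover have "\<bar>theta4 t\<bar> ^ 4 < theta3 t ^ 4"
    using lt by (intro power_strict_mono) auto
  ultimately show False by simp
qed

end
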